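(* Let $B$ be a simple abelian variety, and let $$H\subset \mathrm{End}(H_1(B,\mathbb{Z}))$$ be a subring which is also a sub-Hodge structure (for the weight $2$ Hodge structure on $\mathrm{End}(H_1(B,\mathbb{Z}))$ induced by the weight $1$ Hodge structure on $H_1(B,\mathbb{Z})$). Assume that $H$, with its induced ring structure and weight $2$ Hodge structure, satisfies $H^{2,0}\neq 0$, is polarized by a form $\langle\,,\rangle$, and satisfies: (1) the product $H\otimes H\to H$ is a morphism of Hodge structures of bidegree $(-1,-1)$; (2) there is an involutive endomorphism $t:H\to H$ with $\langle ax,y\rangle=\langle x,t(a)y\rangle$ and $\langle xa,y\rangle=\langle x,yt(a)\rangle$ for all $a,x,y\in H$; (3) the $t$-invariant part of the center of $H$ is $\mathbb{Z}$. Let $A$ be the abelian variety with $H_1(A,\mathbb{Z})=H$ corresponding to the unique polarizable weight $1$ Hodge structure on $H$ for which left multiplication $H\to\mathrm{Hom}(H,H)$ is a morphism of weight $2$ Hodge structures. Then $B$ is a quotient of $A$.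
   Context: Abelian varieties are complex. $H_1(B,\mathbb{Z})$ carries the weight $1$ Hodge structure $H_1(B,\mathbb{C})=H_{1,0}(B)\oplus H_{0,1}(B)$ dual to that of $H^1(B)$, with $B=H_1(B,\mathbb{C})/(H_{1,0}(B)\oplus H_1(B,\mathbb{Z}))$. For a weight $1$ Hodge structure $L_{\mathbb{C}}=L^{1,0}\oplus L^{0,1}$, the induced weight $2$ Hodge structure on $\mathrm{Hom}(L,L)$ has $(2,0)$-part $\mathrm{Hom}(L^{0,1},L^{1,0})$, $(1,1)$-part $\mathrm{End}(L^{1,0})\oplus\mathrm{End}(L^{0,1})$, $(0,2)$-part $\mathrm{Hom}(L^{1,0},L^{0,1})$. A polarization of a weight $2$ Hodge structure $H$ is an integral symmetric bilinear form $\langle\,,\rangle$ such that the Hodge decomposition is orthogonal for $h(\alpha,\beta)=\langle\alpha,\overline\beta\rangle$, with $h$ positive definite on $H^{2,0}$ and $H^{0,2}$ and negative definite on $H^{1,1}$. Bidegree $(-1,-1)$ means $H^{p,q}\cdot H^{r,s}\subset H^{p+r-1,q+s-1}$ (with $H^{p,q}=0$ for $(p,q)\notin\{(2,0),(1,1),(0,2)\}$). Under conditions (1)–(3) it is known that there is a unique polarizable weight $1$ Hodge structure on $H$ such that left multiplication $H\to\mathrm{Hom}(H,H)$ is a morphism of weight $2$ Hodge structures (the target having the weight $2$ structure induced from the weight $1$ structure on $H$); explicitly it is $H_{\mathbb{C}}=W\oplus\overline W$, where the $(1,0)$-part $W=H^{2,0}H_{\mathbb{C}}$ is the span of products of elements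 of $H^{2,0}$ and $H_{\mathbb{C}}$, and $A=H_{\mathbb{C}}/(W\oplus H)$. *)

theory Defs
  imports "HOL-Analysis.Analysis" "HOL-Algebra.Coset"
begin

text \<open>
  A complex coordinate space: \<open>complex\<close>, \<open>complex ^ 'n\<close>, \<open>complex ^ 'n ^ 'm\<close>, \<open>\<dots>\<close>, with complex
  scalar multiplication, coordinatewise conjugation and the set of vectors with integer
  coordinates. The class serves to treat vectors and matrices uniformly.
\<close>

class complex_coord_space = euclidean_space +
  fixes scaleC :: "complex \<Rightarrow> 'a \<Rightarrow> 'a" (infixr "*\<^sub>C" 75)
    and vcnj :: "'a \<Rightarrow> 'a"
    and vints :: "'a set"
  assumes scaleC_add_right: "c *\<^sub>C (x + y) = c *\<^sub>C x + c *\<^sub>C y"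
    and scaleC_add_left: "(c + d) *\<^sub>C x = c *\<^sub>C x + d *\<^sub>C x"
    and scaleC_scaleC: "c *\<^sub>C d *\<^sub>C x = (c * d) *\<^sub>C x"
    and scaleC_of_real: "complex_of_real r *\<^sub>C x = r *\<^sub>R x"
    and vcnj_add: "vcnj (x + y) = vcnj x + vcnj y"
    and vcnj_scaleC: "vcnj (c *\<^sub>C x) = cnj c *\<^sub>C vcnj x"
    and vcnj_vcnj: "vcnj (vcnj x) = x"
    and zero_vints: "0 \<in> vints"
    and diff_vints: "x \<in> vints \<Longrightarrow> y \<in> vints \<Longrightarrow> x - y \<in> vints"
    and vcnj_vints: "x \<in> vints \<Longrightarrow> vcnj x = x"

instantiation complex :: complex_coord_space
begin

definition scaleC_complex :: "complex \<Rightarrow> complex \<Rightarrow> complex"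
  where "scaleC_complex = (*)"

definition vcnj_complex :: "complex \<Rightarrow> complex"
  where "vcnj_complex = cnj"

definition vints_complex :: "complex set"
  where "vints_complex = \<int>"

instance
  by standard
    (auto simp: scaleC_complex_def vcnj_complex_def vints_complex_def algebra_simps scaleR_conv_of_real
      elim: Ints_cases)

end

instantiation vec :: (complex_coord_space, finite) complex_coord_space
begin

definition scaleC_vec :: "complex \<Rightarrow> 'a ^ 'b \<Rightarrow> 'a ^ 'b"
  where "scaleC_vec c x = (\<chi> i. c *\<^sub>C (x $ i))"

definition vcnj_vec :: "'a ^ 'b \<Rightarrow> 'a ^ 'b"
  where "vcnj_vec x = (\<chi> i. vcnj (x $ i))"

definition vints_vec :: "('a ^ 'b) set"
  where "vints_vec = {x. \<forall>i. x $ i \<in> vints}"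

instance
  by standard
    (auto simp: scaleC_vec_def vcnj_vec_def vints_vec_def vec_eq_iff scaleC_add_right scaleC_add_left
      scaleC_scaleC scaleC_of_real vcnj_add vcnj_scaleC vcnj_vcnj zero_vints diff_vints vcnj_vints)

end

abbreviation csubspace :: "'a::complex_coord_space set \<Rightarrow> bool"
  where "csubspace \<equiv> module.subspace scaleC"

abbreviation clinear :: "('a::complex_coord_space \<Rightarrow> 'b::complex_coord_space) \<Rightarrow> bool"
  where "clinear \<equiv> Vector_Spaces.linear scaleC scaleC"

lemma vector_space_scaleC: "vector_space (scaleC :: complex \<Rightarrow> 'a \<Rightarrow> 'a::complex_coord_space)"
  by standard
    (auto simp: scaleC_add_right scaleC_add_left scaleC_scaleC scaleC_of_real[of 1, simplified])

definition clinear_on :: "'a::complex_coord_space set \<Rightarrow> ('a \<Rightarrow> complex) \<Rightarrow> bool"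
  where "clinear_on S f \<longleftrightarrow>
    (\<forall>x\<in>S. \<forall>y\<in>S. f (x + y) = f x + f y) \<and> (\<forall>c. \<forall>x\<in>S. f (c *\<^sub>C x) = c * f x)"

definition cbilinear_on :: "'a::complex_coord_space set \<Rightarrow> ('a \<Rightarrow> 'a \<Rightarrow> complex) \<Rightarrow> bool"
  where "cbilinear_on S Q \<longleftrightarrow>
    (\<forall>y\<in>S. clinear_on S (\<lambda>x. Q x y)) \<and> (\<forall>x\<in>S. clinear_on S (\<lambda>y. Q x y))"

text \<open>
  Finitely generated free abelian groups are presented as subgroups \<open>L\<close> of the integral vectors of
  a coordinate space. Vectors in \<open>\<int>\<^sup>N\<close> that are independent over \<open>\<int>\<close> are independent over
  the complex numbers, so the complex span of \<open>L\<close> is the tensor product of \<open>L\<close> with the complex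
  numbers, and \<^term>\<open>vcnj\<close> restricts to its complex conjugation.
\<close>

definition int_lattice :: "'a::complex_coord_space set \<Rightarrow> bool"
  where "int_lattice L \<longleftrightarrow> L \<subseteq> vints \<and> 0 \<in> L \<and> (\<forall>x\<in>L. \<forall>y\<in>L. x - y \<in> L)"

definition complexify :: "'a::complex_coord_space set \<Rightarrow> 'a set"
  where "complexify L = module.span scaleC L"

text \<open>
  Effective Hodge structures of weight \<open>k\<close>; \<open>F p q\<close> is the \<open>(p,q)\<close>-part.
\<close>

definition hodge_structure ::
    "int \<Rightarrow> 'a::complex_coord_space set \<Rightarrow> (int \<Rightarrow> int \<Rightarrow> 'a set) \<Rightarrow> bool"
  where "hodge_structure k L F \<longleftrightarrow>
    int_lattice L \<and>
    (\<forall>p q. csubspace (F p q) \<and> F p q \<subseteq> complexify L \<and> vcnj ` F p q = F q p) \<and>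
    (\<forall>p q. \<not> (0 \<le> p \<and> 0 \<le> q \<and> p + q = k) \<longrightarrow> F p q = {0}) \<and>
    (\<forall>x\<in>complexify L. \<exists>!c. (\<forall>p. c p \<in> F p (k - p)) \<and> x = (\<Sum>p=0..k. c p))"

definition induced_hodge ::
    "'a::complex_coord_space set \<Rightarrow> (int \<Rightarrow> int \<Rightarrow> 'a set) \<Rightarrow> int \<Rightarrow> int \<Rightarrow> 'a set"
  where "induced_hodge H F p q = F p q \<inter> complexify H"

definition sub_hodge_structure ::
    "int \<Rightarrow> 'a::complex_coord_space set \<Rightarrow> (int \<Rightarrow> int \<Rightarrow> 'a set) \<Rightarrow> 'a set \<Rightarrow> bool"
  where "sub_hodge_structure k L F H \<longleftrightarrow> H \<subseteq> L \<and> hodge_structure k H (induced_hodge H F)"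

text \<open>
  Elements of the complexification of \<open>Hom(L,L)\<close> are represented by complex linear maps of the
  ambient space that preserve \<^term>\<open>complexify L\<close>; only their restriction to it matters.
\<close>

definition hom_hodge ::
    "'a::complex_coord_space set \<Rightarrow> (int \<Rightarrow> int \<Rightarrow> 'a set) \<Rightarrow> int \<Rightarrow> int \<Rightarrow> ('a \<Rightarrow> 'a) set"
  where "hom_hodge L F p q = {f. clinear f \<and> f ` complexify L \<subseteq> complexify L \<and>
    (if (p, q) = (2, 0) then f ` F 1 0 \<subseteq> {0} \<and> f ` F 0 1 \<subseteq> F 1 0
     else if (p, q) = (1, 1) then f ` F 1 0 \<subseteq> F 1 0 \<and> f ` F 0 1 \<subseteq> F 0 1
     else if (p, q) = (0, 2) then f ` F 1 0 \<subseteq> F 0 1 \<and> f ` F 0 1 \<subseteq> {0}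
     else f ` complexify L \<subseteq> {0})}"

text \<open>
  For \<open>L = \<int>\<^sup>n\<close>, the ring \<open>End(L)\<close> is the ring of integral matrices, and its complexification
  the ring of complex matrices.
\<close>

definition End_hodge ::
    "(int \<Rightarrow> int \<Rightarrow> (complex ^ 'n) set) \<Rightarrow> int \<Rightarrow> int \<Rightarrow> (complex ^ 'n ^ 'n) set"
  where "End_hodge F p q = {M. (\<lambda>x. M *v x) \<in> hom_hodge vints F p q}"

text \<open>Integral forms are given by their complex bilinear extensions.\<close>

definition integral_form ::
    "'a::complex_coord_space set \<Rightarrow> ('a \<Rightarrow> 'a \<Rightarrow> complex) \<Rightarrow> bool"
  where "integral_form L Q \<longleftrightarrow>
    cbilinear_on (complexify L) Q \<and> (\<forall>x\<in>L. \<forall>y\<in>L. Q x y \<in> \<int>)"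

definition pos_real :: "complex \<Rightarrow> bool"
  where "pos_real z \<longleftrightarrow> z \<in> \<real> \<and> Re z > 0"

text \<open>The sign convention is immaterial: it is absorbed by replacing \<open>E\<close> with \<open>- E\<close>.\<close>

definition polarizable_weight1 ::
    "'a::complex_coord_space set \<Rightarrow> (int \<Rightarrow> int \<Rightarrow> 'a set) \<Rightarrow> bool"
  where "polarizable_weight1 L F \<longleftrightarrow> (\<exists>E. integral_form L E \<and>
    (\<forall>x\<in>complexify L. \<forall>y\<in>complexify L. E x y = - E y x) \<and>
    (\<forall>x\<in>F 1 0. \<forall>y\<in>F 0 1. E x (vcnj y) = 0) \<and>
    (\<forall>x\<in>F 1 0. x \<noteq> 0 \<longrightarrow> pos_real (\<i> * E x (vcnj x))))"

definition polarization_weight2 ::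
    "'a::complex_coord_space set \<Rightarrow> (int \<Rightarrow> int \<Rightarrow> 'a set) \<Rightarrow> ('a \<Rightarrow> 'a \<Rightarrow> complex) \<Rightarrow> bool"
  where "polarization_weight2 L F Q \<longleftrightarrow> integral_form L Q \<and>
    (\<forall>x\<in>complexify L. \<forall>y\<in>complexify L. Q x y = Q y x) \<and>
    (\<forall>p q r s. (p, q) \<noteq> (r, s) \<longrightarrow> (\<forall>x\<in>F p q. \<forall>y\<in>F r s. Q x (vcnj y) = 0)) \<and>
    (\<forall>x\<in>F 2 0 \<union> F 0 2. x \<noteq> 0 \<longrightarrow> pos_real (Q x (vcnj x))) \<and>
    (\<forall>x\<in>F 1 1. x \<noteq> 0 \<longrightarrow> pos_real (- Q x (vcnj x)))"

text \<open>
  An abelian variety with first homology lattice \<open>L\<close> is the complex torus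
  \<open>L\<^sub>C / (L\<^sup>1\<^sup>0 + L)\<close> of a polarizable weight 1 Hodge structure on \<open>L\<close>.
\<close>

definition vec_group :: "'a::complex_coord_space set \<Rightarrow> 'a monoid"
  where "vec_group V = \<lparr>carrier = V, monoid.mult = (+), one = 0\<rparr>"

definition period_group ::
    "'a::complex_coord_space set \<Rightarrow> (int \<Rightarrow> int \<Rightarrow> 'a set) \<Rightarrow> 'a set"
  where "period_group L F = {w + l | w l. w \<in> F 1 0 \<and> l \<in> L}"

definition torus ::
    "'a::complex_coord_space set \<Rightarrow> (int \<Rightarrow> int \<Rightarrow> 'a set) \<Rightarrow> 'a set monoid"
  where "torus L F = vec_group (complexify L) Mod period_group L F"

definition torus_proj ::
    "'a::complex_coord_space set \<Rightarrow> (int \<Rightarrow> int \<Rightarrow> 'a set) \<Rightarrow> 'a \<Rightarrow> 'a set"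
  where "torus_proj L F x = period_group L F #>\<^bsub>vec_group (complexify L)\<^esub> x"

definition abelian_variety ::
    "'a::complex_coord_space set \<Rightarrow> (int \<Rightarrow> int \<Rightarrow> 'a set) \<Rightarrow> bool"
  where "abelian_variety L F \<longleftrightarrow> hodge_structure 1 L F \<and> polarizable_weight1 L F"

text \<open>
  The projections from the complexified lattices to the tori are holomorphic submersions, so a map
  of tori is holomorphic iff it locally lifts to a holomorphic map of the complexified lattices.
\<close>

definition torus_holomorphic ::
    "'a::complex_coord_space set \<Rightarrow> (int \<Rightarrow> int \<Rightarrow> 'a set) \<Rightarrow>
     'b::complex_coord_space set \<Rightarrow> (int \<Rightarrow> int \<Rightarrow> 'b set) \<Rightarrow> ('a set \<Rightarrow> 'b set) \<Rightarrow> bool"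
  where "torus_holomorphic L F L' F' \<phi> \<longleftrightarrow>
    (\<forall>x\<in>complexify L. \<exists>U f. open U \<and> x \<in> U \<and>
      (\<forall>y\<in>U \<inter> complexify L. f y \<in> complexify L' \<and>
        \<phi> (torus_proj L F y) = torus_proj L' F' (f y) \<and>
        (\<exists>D. clinear D \<and> (f has_derivative D) (at y within complexify L))))"

definition abelian_variety_hom ::
    "'a::complex_coord_space set \<Rightarrow> (int \<Rightarrow> int \<Rightarrow> 'a set) \<Rightarrow>
     'b::complex_coord_space set \<Rightarrow> (int \<Rightarrow> int \<Rightarrow> 'b set) \<Rightarrow> ('a set \<Rightarrow> 'b set) \<Rightarrow> bool"
  where "abelian_variety_hom L F L' F' \<phi> \<longleftrightarrow>
    \<phi> \<in> hom (torus L F) (torus L' F') \<and> torus_holomorphic L F L' F' \<phi>"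

definition abelian_variety_quotient ::
    "'a::complex_coord_space set \<Rightarrow> (int \<Rightarrow> int \<Rightarrow> 'a set) \<Rightarrow>
     'b::complex_coord_space set \<Rightarrow> (int \<Rightarrow> int \<Rightarrow> 'b set) \<Rightarrow> bool"
  where "abelian_variety_quotient L F L' F' \<longleftrightarrow>
    (\<exists>\<phi>. abelian_variety_hom L F L' F' \<phi> \<and> \<phi> ` carrier (torus L F) = carrier (torus L' F'))"

text \<open>
  An abelian subvariety is the image of an injective homomorphism from an abelian variety. Its
  homology lattice has rank at most that of \<open>L\<close>, so it can be presented in the same ambient space.
\<close>

definition abelian_subvariety ::
    "'a::complex_coord_space set set \<Rightarrow> 'a set \<Rightarrow> (int \<Rightarrow> int \<Rightarrow> 'a set) \<Rightarrow> bool"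
  where "abelian_subvariety S L F \<longleftrightarrow>
    (\<exists>(M :: 'a set) G \<phi>. abelian_variety M G \<and> abelian_variety_hom M G L F \<phi> \<and>
      inj_on \<phi> (carrier (torus M G)) \<and> S = \<phi> ` carrier (torus M G))"

definition simple_abelian_variety ::
    "'a::complex_coord_space set \<Rightarrow> (int \<Rightarrow> int \<Rightarrow> 'a set) \<Rightarrow> bool"
  where "simple_abelian_variety L F \<longleftrightarrow>
    abelian_variety L F \<and> carrier (torus L F) \<noteq> {\<one>\<^bsub>torus L F\<^esub>} \<and>
    (\<forall>S. abelian_subvariety S L F \<longrightarrow> S = {\<one>\<^bsub>torus L F\<^esub>} \<or> S = carrier (torus L F))"

definition matrix_subring :: "(complex ^ 'n ^ 'n) set \<Rightarrow> bool"
  where "matrix_subring H \<longleftrightarrow>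
    mat 1 \<in> H \<and> (\<forall>a\<in>H. \<forall>b\<in>H. a - b \<in> H \<and> a ** b \<in> H)"

definition product_bidegree_minus_one ::
    "(int \<Rightarrow> int \<Rightarrow> (complex ^ 'n ^ 'n) set) \<Rightarrow> bool"
  where "product_bidegree_minus_one F \<longleftrightarrow>
    (\<forall>p q r s. \<forall>a\<in>F p q. \<forall>b\<in>F r s. a ** b \<in> F (p + r - 1) (q + s - 1))"

definition involutive_endomorphism ::
    "'a::ab_group_add set \<Rightarrow> ('a \<Rightarrow> 'a) \<Rightarrow> bool"
  where "involutive_endomorphism H t \<longleftrightarrow>
    t ` H \<subseteq> H \<and> (\<forall>a\<in>H. \<forall>b\<in>H. t (a + b) = t a + t b) \<and> (\<forall>a\<in>H. t (t a) = a)"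

definition matrix_center :: "(complex ^ 'n ^ 'n) set \<Rightarrow> (complex ^ 'n ^ 'n) set"
  where "matrix_center H = {z \<in> H. \<forall>a\<in>H. z ** a = a ** z}"

text \<open>
  Left multiplication \<open>H \<rightarrow> Hom(H,H)\<close> is a morphism from the weight 2 structure \<open>F\<close> on \<open>H\<close> to the
  weight 2 structure induced by a weight 1 structure \<open>G\<close> on \<open>H\<close>.
\<close>

definition left_mult_hodge_morphism ::
    "(complex ^ 'n ^ 'n) set \<Rightarrow> (int \<Rightarrow> int \<Rightarrow> (complex ^ 'n ^ 'n) set) \<Rightarrow>
     (int \<Rightarrow> int \<Rightarrow> (complex ^ 'n ^ 'n) set) \<Rightarrow> bool"
  where "left_mult_hodge_morphism H F G \<longleftrightarrow>
    (\<forall>p q. \<forall>a\<in>F p q. (\<lambda>x. a ** x) \<in> hom_hodge H G p q)"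

end

theory Submission
  imports Defs
begin

text \<open>
  Write \<open>1 = e + f\<close> where \<open>e\<close> lies in the two-sided ideal generated by \<open>H\<^sup>2\<^sup>0\<close> and \<open>H\<^sup>0\<^sup>2\<close>, and \<open>f\<close>
  is orthogonal to it. Then \<open>f\<close> is central, fixed by \<open>t\<close>, and kills \<open>H\<^sup>2\<^sup>0\<close>, so hypothesis (3)
  gives \<open>f = 0\<close>; thus \<open>1\<close> is a combination of products \<open>a b\<close> with one factor in \<open>H\<^sup>2\<^sup>0\<close> and the
  other in \<open>H\<^sup>0\<^sup>2\<close>. For \<open>x\<close> in the (1,0)-part of \<open>A\<close> the products with \<open>b \<in> H\<^sup>2\<^sup>0\<close> satisfy
  \<open>b x = 0\<close>, and for \<open>a \<in> H\<^sup>2\<^sup>0\<close> the operator \<open>a\<close> maps everything into the (1,0)-part of \<open>B\<close>.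
  Hence evaluation \<open>x \<mapsto> x v\<close> at a nonzero integral vector \<open>v\<close> is a morphism of Hodge structures
  and induces a nonzero homomorphism from \<open>A\<close> to \<open>B\<close>, which is onto because \<open>B\<close> is simple.
\<close>

section \<open>Complex linear algebra over lattices\<close>

interpretation cvec: vector_space "scaleC :: complex \<Rightarrow> 'a \<Rightarrow> 'a::complex_coord_space"
  by (rule vector_space_scaleC)

interpretation cvec_pair: vector_space_pair
    "scaleC :: complex \<Rightarrow> 'a \<Rightarrow> 'a::complex_coord_space"
    "scaleC :: complex \<Rightarrow> 'b \<Rightarrow> 'b::complex_coord_space"
  by standard

lemma clinearI:
  assumes "\<And>x y. f (x + y) = f x + f y" "\<And>c x. f (c *\<^sub>C x) = c *\<^sub>C f x"
  shows "clinear f"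
  using assms by (simp add: Vector_Spaces.linear_iff vector_space_scaleC)

lemma clinear_imp_bounded_linear:
  assumes "clinear f"
  shows "bounded_linear f"
proof -
  have "linear f"
    by (rule linearI)
      (simp_all add: cvec_pair.linear_add[OF assms] cvec_pair.linear_scale[OF assms] flip: scaleC_of_real)
  then show ?thesis
    by (simp add: linear_conv_bounded_linear)
qed

lemma vcnj_zero [simp]: "vcnj (0::'a::complex_coord_space) = 0"
  using zero_vints vcnj_vints by blast

lemma subspace_complexify: "csubspace (complexify L)"
  unfolding complexify_def by (rule cvec.subspace_span)

lemma subset_complexify: "x \<in> L \<Longrightarrow> x \<in> complexify L"
  unfolding complexify_def by (rule cvec.span_base)

text \<open>The addition and scaling cases carry membership in \<open>complexify L\<close>, because
  forms such as \<open>Q\<close> are only known to be bilinear there.\<close>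

lemma complexify_induct [consumes 1, case_names zero add scale base]:
  assumes "x \<in> complexify L"
    and "P 0" "\<And>x y. x \<in> complexify L \<Longrightarrow> y \<in> complexify L \<Longrightarrow> P x \<Longrightarrow> P y \<Longrightarrow> P (x + y)"
    and "\<And>c x. x \<in> complexify L \<Longrightarrow> P x \<Longrightarrow> P (c *\<^sub>C x)" "\<And>x. x \<in> L \<Longrightarrow> P x"
  shows "P x"
proof -
  have "x \<in> complexify L \<and> P x"
    using assms(1) unfolding complexify_def
  proof (rule cvec.span_induct)
    show "csubspace {x. x \<in> module.span scaleC L \<and> P x}"
      using assms(2-4) unfolding complexify_def
      by (auto simp: cvec.subspace_def cvec.span_zero cvec.span_add cvec.span_scale)
  qed (auto simp: cvec.span_base assms(5))
  then show ?thesis ..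
qed

lemma int_lattice_subgroup:
  assumes "int_lattice L"
  shows "0 \<in> L" "x \<in> L \<Longrightarrow> - x \<in> L" "x \<in> L \<Longrightarrow> y \<in> L \<Longrightarrow> x + y \<in> L" "x \<in> L \<Longrightarrow> y \<in> L \<Longrightarrow> x - y \<in> L"
    "x \<in> L \<Longrightarrow> vcnj x = x"
proof -
  show 0: "0 \<in> L" and d: "x \<in> L \<Longrightarrow> y \<in> L \<Longrightarrow> x - y \<in> L" for x y
    using assms unfolding int_lattice_def by auto
  show m: "x \<in> L \<Longrightarrow> - x \<in> L" for x
    using d[OF 0] by simp
  show "x \<in> L \<Longrightarrow> y \<in> L \<Longrightarrow> x + y \<in> L"
    using d[OF _ m, of x y] by simp
  show "x \<in> L \<Longrightarrow> vcnj x = x"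
    using assms vcnj_vints unfolding int_lattice_def by auto
qed

lemma int_lattice_scale:
  assumes "int_lattice L" "x \<in> L"
  shows "of_int n *\<^sub>C x \<in> L"
proof -
  have nat: "of_nat n *\<^sub>C x \<in> L" for n
    using assms
    by (induction n) (auto simp: int_lattice_subgroup[OF assms(1)] cvec.scale_left_distrib)
  show ?thesis
  proof (cases "0 \<le> n")
    case True
    then show ?thesis
      using nat[of "nat n"] by simp
  next
    case False
    then have "of_int n *\<^sub>C x = - (of_nat (nat (- n)) *\<^sub>C x)"
      by (simp flip: cvec.scale_minus_left)
    then show ?thesis
      using nat int_lattice_subgroup(2)[OF assms(1)] by metis
  qed
qed

text \<open>The generators of the span are integral, hence fixed by conjugation, and conjugation is
  semilinear.\<close>

lemma vcnj_complexify:
  assumes "int_lattice L" "x \<in> complexify L"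
  shows "vcnj x \<in> complexify L"
  using assms(2)
  by (induction rule: complexify_induct)
    (auto simp: vcnj_add vcnj_scaleC int_lattice_subgroup(5)[OF assms(1)] subset_complexify
      intro: cvec.subspace_add cvec.subspace_scale cvec.subspace_0 subspace_complexify)

lemma complexify_image:
  assumes "clinear f"
  shows "complexify (f ` L) = f ` complexify L"
  unfolding complexify_def by (rule cvec_pair.linear_span_image[OF assms])

section \<open>Homomorphisms of complex tori\<close>

text \<open>In weight 1 only the parts (1,0) and (0,1) survive, so the unique family
  \<open>c\<close> of the definition amounts to a direct sum of two pieces.\<close>

lemma hodge_structure_weight1:
  assumes "hodge_structure 1 L F"
  shows "int_lattice L" "csubspace (F p q)" "F p q \<subseteq> complexify L" "vcnj ` F p q = F q p"
    and "x \<in> complexify L \<Longrightarrow> \<exists>a\<in>F 1 0. \<exists>b\<in>F 0 1. x = a + b"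
    and "a \<in> F 1 0 \<Longrightarrow> a \<in> F 0 1 \<Longrightarrow> a = 0"
proof -
  show *: "int_lattice L" "csubspace (F p q)" "F p q \<subseteq> complexify L" "vcnj ` F p q = F q p" for p q
    using assms unfolding hodge_structure_def by auto
  have dec: "\<exists>!c. (\<forall>p. c p \<in> F p (1 - p)) \<and> x = (\<Sum>p=0..1::int. c p)" if "x \<in> complexify L" for x
    using assms that unfolding hodge_structure_def by auto
  have set: "{0..1::int} = {0, 1}"
    by auto
  show "\<exists>a\<in>F 1 0. \<exists>b\<in>F 0 1. x = a + b" if x: "x \<in> complexify L"
  proof -
    from dec[OF x] obtain c where "\<forall>p. c p \<in> F p (1 - p)" "x = (\<Sum>p=0..1::int. c p)"
      by blast
    then show ?thesis
      using spec[of "\<lambda>p. c p \<in> F p (1 - p)" 0] spec[of "\<lambda>p. c p \<in> F p (1 - p)" 1]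
      by (auto simp: set add.commute)
  qed
  show "a = 0" if a: "a \<in> F 1 0" "a \<in> F 0 1"
  proof -
    have 0: "0 \<in> F p q" for p q
      by (rule cvec.subspace_0[OF *(2)])
    have "a \<in> complexify L"
      using a(1) *(3)[of 1 0] by blast
    then have unique: "c = c'"
      if "(\<forall>p. c p \<in> F p (1 - p)) \<and> a = (\<Sum>p=0..1. c p)"
        "(\<forall>p. c' p \<in> F p (1 - p)) \<and> a = (\<Sum>p=0..1. c' p)" for c c'
      using dec that by blast
    \<comment> \<open>An element of both parts has two decompositions, one concentrated at
      \<open>p = 1\<close> and one at \<open>p = 0\<close>; uniqueness identifies them.\<close>
    have "(\<lambda>p::int. if p = 1 then a else 0) = (\<lambda>p. if p = 0 then a else 0)"
      by (rule unique) (use a 0 in \<open>auto simp: set\<close>)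
    then show ?thesis
      by (metis zero_neq_one)
  qed
qed

text \<open>Two decompositions differ by an element common to both parts, which \<open>inter\<close>
  makes zero; \<open>zero\<close> settles all other indices.\<close>

lemma hodge_structure_weight1I:
  assumes "int_lattice L" "\<And>p q. csubspace (F p q)" "\<And>p q. F p q \<subseteq> complexify L"
    and "\<And>p q. vcnj ` F p q = F q p"
    and zero: "\<And>p q. \<not> (0 \<le> p \<and> 0 \<le> q \<and> p + q = 1) \<Longrightarrow> F p q = {0}"
    and dec: "\<And>x. x \<in> complexify L \<Longrightarrow> \<exists>a\<in>F 1 0. \<exists>b\<in>F 0 1. x = a + b"
    and inter: "\<And>a. a \<in> F 1 0 \<Longrightarrow> a \<in> F 0 1 \<Longrightarrow> a = 0"
  shows "hodge_structure 1 L F"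
  unfolding hodge_structure_def
proof (intro conjI allI impI ballI)
  fix x assume "x \<in> complexify L"
  then obtain a b where ab: "a \<in> F 1 0" "b \<in> F 0 1" "x = a + b"
    using dec by blast
  have set: "{0..1::int} = {0, 1}"
    by auto
  show "\<exists>!c. (\<forall>p. c p \<in> F p (1 - p)) \<and> x = (\<Sum>p=0..1. c p)"
  proof (rule ex1I[where a = "\<lambda>p. if p = 1 then a else if p = 0 then b else 0"])
    show "(\<forall>p. (if p = 1 then a else if p = 0 then b else 0) \<in> F p (1 - p)) \<and>
      x = (\<Sum>p=0..1::int. if p = 1 then a else if p = 0 then b else 0)"
      using ab cvec.subspace_0[OF assms(2)] by (auto simp: set)
  next
    fix c assume c: "(\<forall>p. c p \<in> F p (1 - p)) \<and> x = (\<Sum>p=0..1. c p)"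
    then have c01: "c 1 \<in> F 1 0" "c 0 \<in> F 0 1" "x = c 0 + c 1"
      using spec[of "\<lambda>p. c p \<in> F p (1 - p)" 0] spec[of "\<lambda>p. c p \<in> F p (1 - p)" 1]
      by (auto simp: set)
    have "c 1 - a = b - c 0"
      using ab(3) c01(3) by (simp add: algebra_simps)
    moreover have "c 1 - a \<in> F 1 0" "b - c 0 \<in> F 0 1"
      using ab c01 cvec.subspace_diff[OF assms(2)] by blast+
    ultimately have "c 1 - a = 0"
      by (metis inter)
    moreover have "c 0 = b"
      using \<open>c 1 - a = b - c 0\<close> calculation by simp
    moreover have "c p = 0" if "p \<noteq> 0" "p \<noteq> 1" for p
    proof -
      have "F p (1 - p) = {0}"
        using that by (intro zero) auto
      then show ?thesis
        using c by blast
    qed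
    ultimately show "c = (\<lambda>p. if p = 1 then a else if p = 0 then b else 0)"
      by auto
  qed
qed (use assms in auto)

section \<open>The torus as a quotient group\<close>

lemma comm_group_vec_group:
  assumes "csubspace V"
  shows "comm_group (vec_group V)"
proof (rule comm_groupI)
  show "\<exists>y\<in>carrier (vec_group V). y \<otimes>\<^bsub>vec_group V\<^esub> x = \<one>\<^bsub>vec_group V\<^esub>"
    if "x \<in> carrier (vec_group V)" for x
    using that cvec.subspace_neg[OF assms]
    by (intro bexI[of _ "- x"]) (auto simp: vec_group_def)
qed (auto simp: vec_group_def algebra_simps cvec.subspace_add[OF assms] cvec.subspace_0[OF assms])

lemma m_inv_vec_group:
  assumes "csubspace V" "x \<in> V"
  shows "inv\<^bsub>vec_group V\<^esub> x = - x"
proof -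
  interpret comm_group "vec_group V"
    by (rule comm_group_vec_group[OF assms(1)])
  show ?thesis
    using assms cvec.subspace_neg[OF assms]
    by (intro inv_equality) (auto simp: vec_group_def)
qed

context
  fixes L :: "'a::complex_coord_space set" and F
  assumes hodge: "hodge_structure 1 L F"
begin

lemmas hodge_facts = hodge_structure_weight1[OF hodge]

lemma period_group_subset: "period_group L F \<subseteq> complexify L"
  using hodge_facts(3) subset_complexify
  unfolding period_group_def by (auto intro!: cvec.subspace_add[OF subspace_complexify])

lemma period_group_diff:
  "x \<in> period_group L F \<Longrightarrow> y \<in> period_group L F \<Longrightarrow> x - y \<in> period_group L F"
  unfolding period_group_def
proof clarsimp
  fix w l w' l' assume "w \<in> F 1 0" "l \<in> L" "w' \<in> F 1 0" "l' \<in> L"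
  then show "\<exists>v k. w + l - (w' + l') = v + k \<and> v \<in> F 1 0 \<and> k \<in> L"
    using cvec.subspace_diff[OF hodge_facts(2)] int_lattice_subgroup(4)[OF hodge_facts(1)]
    by (intro exI[of _ "w - w'"] exI[of _ "l - l'"]) auto
qed

lemma zero_period_group: "0 \<in> period_group L F"
  unfolding period_group_def
  using cvec.subspace_0[OF hodge_facts(2)] int_lattice_subgroup(1)[OF hodge_facts(1)]
  by force

lemma period_group_uminus: "x \<in> period_group L F \<Longrightarrow> - x \<in> period_group L F"
  using period_group_diff[OF zero_period_group] by force

lemma period_group_normal: "period_group L F \<lhd> vec_group (complexify L)"
proof (rule comm_group.subgroup_imp_normal)
  show grp: "comm_group (vec_group (complexify L))"
    by (rule comm_group_vec_group[OF subspace_complexify])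
  show "subgroup (period_group L F) (vec_group (complexify L))"
  proof (rule group.subgroupI)
    show "group (vec_group (complexify L))"
      using grp by (simp add: comm_group_def)
    show "inv\<^bsub>vec_group (complexify L)\<^esub> a \<in> period_group L F" if "a \<in> period_group L F" for a
      using that period_group_uminus period_group_subset
      by (subst m_inv_vec_group[OF subspace_complexify]) auto
    show "a \<otimes>\<^bsub>vec_group (complexify L)\<^esub> b \<in> period_group L F"
      if "a \<in> period_group L F" "b \<in> period_group L F" for a b
      using period_group_diff[OF that(1) period_group_uminus[OF that(2)]]
      by (simp add: vec_group_def)
  qed (use zero_period_group period_group_subset in \<open>auto simp: vec_group_def\<close>)
qed

lemma mem_torus_proj: "y \<in> torus_proj L F x \<longleftrightarrow> y - x \<in> period_group L F"
  unfolding torus_proj_def r_coset_def vec_group_def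
  by (auto simp: algebra_simps) (metis add_diff_cancel_left' diff_add_cancel add.commute)

lemma torus_proj_eq_iff: "torus_proj L F x = torus_proj L F y \<longleftrightarrow> x - y \<in> period_group L F"
proof
  assume "torus_proj L F x = torus_proj L F y"
  then show "x - y \<in> period_group L F"
    using mem_torus_proj zero_period_group by (metis diff_self)
next
  assume *: "x - y \<in> period_group L F"
  have "z - x \<in> period_group L F \<longleftrightarrow> z - y \<in> period_group L F" for z
    using period_group_diff[of "z - y" "x - y"] period_group_diff[of "z - x" "- (x - y)"]
      period_group_uminus[OF *] * by auto
  then show "torus_proj L F x = torus_proj L F y"
    by (auto simp: mem_torus_proj)
qed

lemma carrier_torus: "carrier (torus L F) = torus_proj L F ` complexify L"
  unfolding torus_def torus_proj_def FactGroup_def RCOSETS_def by (auto simp: vec_group_def)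

lemma one_torus: "\<one>\<^bsub>torus L F\<^esub> = torus_proj L F 0"
  unfolding torus_def FactGroup_def by (auto simp: mem_torus_proj)

lemma mult_torus:
  assumes "x \<in> complexify L" "y \<in> complexify L"
  shows "torus_proj L F x \<otimes>\<^bsub>torus L F\<^esub> torus_proj L F y = torus_proj L F (x + y)"
  using normal.rcos_sum[OF period_group_normal, of x y] assms
  unfolding torus_def torus_proj_def FactGroup_def by (simp add: vec_group_def)

end

section \<open>Morphisms of Hodge structures and the maps of tori they induce\<close>

text \<open>Taking the union over the whole coset avoids choosing a representative. It is a single
  coset as soon as \<open>f\<close> carries periods to periods.\<close>

definition induced_torus_map ::
    "'b::complex_coord_space set \<Rightarrow> (int \<Rightarrow> int \<Rightarrow> 'b set) \<Rightarrow> ('a \<Rightarrow> 'b) \<Rightarrow> 'a set \<Rightarrow> 'b set"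
  where "induced_torus_map L' F' f S = (\<Union>x\<in>S. torus_proj L' F' (f x))"

text \<open>Only the (1,0)-part is prescribed; compatibility with the (0,1)-part follows by
  conjugation in \<open>part01\<close>.\<close>

locale hodge_morphism =
  fixes L :: "'a::complex_coord_space set" and F
    and L' :: "'b::complex_coord_space set" and F' and f
  assumes source: "hodge_structure 1 L F" and target: "hodge_structure 1 L' F'"
    and clinear: "clinear f" and lattice: "f ` L \<subseteq> L'" and part10: "f ` F 1 0 \<subseteq> F' 1 0"
begin

lemma map_complexify: "f ` complexify L \<subseteq> complexify L'"
  unfolding complexify_image[OF clinear, symmetric] unfolding complexify_def
  by (rule cvec.span_mono[OF lattice])

lemma map_period_group: "x \<in> period_group L F \<Longrightarrow> f x \<in> period_group L' F'"
  using lattice part10 unfolding period_group_def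
  by (force simp: cvec_pair.linear_add[OF clinear])

lemma induced_torus_proj:
  "induced_torus_map L' F' f (torus_proj L F x) = torus_proj L' F' (f x)"
proof -
  have "torus_proj L' F' (f y) = torus_proj L' F' (f x)" if "y \<in> torus_proj L F x" for y
    using that map_period_group
    by (simp add: mem_torus_proj[OF source] torus_proj_eq_iff[OF target]
        flip: cvec_pair.linear_diff[OF clinear])
  moreover have "x \<in> torus_proj L F x"
    by (simp add: mem_torus_proj[OF source] zero_period_group[OF source])
  ultimately show ?thesis
    unfolding induced_torus_map_def by blast
qed

text \<open>The linear map \<open>f\<close> is a global lift of the induced map and is its own
  derivative, which gives holomorphy.\<close>

lemma abelian_variety_hom: "abelian_variety_hom L F L' F' (induced_torus_map L' F' f)"
  unfolding abelian_variety_hom_def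
proof
  show "induced_torus_map L' F' f \<in> hom (torus L F) (torus L' F')"
  proof (rule homI)
    show "induced_torus_map L' F' f x \<in> carrier (torus L' F')" if "x \<in> carrier (torus L F)" for x
      using that map_complexify by (auto simp: carrier_torus source target induced_torus_proj)
    show "induced_torus_map L' F' f (x \<otimes>\<^bsub>torus L F\<^esub> y) =
        induced_torus_map L' F' f x \<otimes>\<^bsub>torus L' F'\<^esub> induced_torus_map L' F' f y"
      if xy: "x \<in> carrier (torus L F)" "y \<in> carrier (torus L F)" for x y
    proof -
      obtain u v where uv: "x = torus_proj L F u" "y = torus_proj L F v"
        "u \<in> complexify L" "v \<in> complexify L"
        using xy by (auto simp: carrier_torus[OF source])
      then have "f u \<in> complexify L'" "f v \<in> complexify L'"
        using map_complexify by auto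
      then show ?thesis
        using uv by (simp add: mult_torus source target induced_torus_proj
            cvec_pair.linear_add[OF clinear])
    qed
  qed
  show "torus_holomorphic L F L' F' (induced_torus_map L' F' f)"
    unfolding torus_holomorphic_def
  proof
    fix x
    show "\<exists>U g. open U \<and> x \<in> U \<and> (\<forall>y\<in>U \<inter> complexify L. g y \<in> complexify L' \<and>
        induced_torus_map L' F' f (torus_proj L F y) = torus_proj L' F' (g y) \<and>
        (\<exists>D. clinear D \<and> (g has_derivative D) (at y within complexify L)))"
      using map_complexify clinear
        bounded_linear_imp_has_derivative[OF clinear_imp_bounded_linear[OF clinear]]
      by (intro exI[of _ UNIV] exI[of _ f]) (auto simp: induced_torus_proj)
  qed
qed

lemma image_carrier:
  "induced_torus_map L' F' f ` carrier (torus L F) = torus_proj L' F' ` f ` complexify L"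
  by (simp add: carrier_torus[OF source] image_image induced_torus_proj)

text \<open>A map defined on the lattices commutes with complex conjugation, and conjugation
  exchanges the two parts.\<close>

lemma part01: "f ` F 0 1 \<subseteq> F' 0 1"
proof -
  have conj: "f (vcnj x) = vcnj (f x)" if "x \<in> complexify L" for x
    using that
  proof (induction rule: complexify_induct)
    case (base x)
    then have "vcnj x = x" "vcnj (f x) = f x"
      using lattice int_lattice_subgroup(5) hodge_structure_weight1(1)[OF source]
        hodge_structure_weight1(1)[OF target] by blast+
    then show ?case
      by simp
  qed (simp_all add: vcnj_add vcnj_scaleC cvec_pair.linear_0[OF clinear]
      cvec_pair.linear_add[OF clinear] cvec_pair.linear_scale[OF clinear])
  show ?thesis
  proof safe
    fix x assume "x \<in> F 0 1"
    then obtain y where y: "x = vcnj y" "y \<in> F 1 0"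
      using hodge_structure_weight1(4)[OF source, of 1 0] by auto
    then have "f x = vcnj (f y)"
      using conj hodge_structure_weight1(3)[OF source] by blast
    then show "f x \<in> F' 0 1"
      using y part10 hodge_structure_weight1(4)[OF target, of 1 0] by auto
  qed
qed

text \<open>
  The image torus is presented by the saturated lattice, so that its inclusion into the target
  is injective and not merely an isogeny onto its image.
\<close>

lemma abelian_subvariety_image:
  assumes pol: "polarizable_weight1 L' F'"
  shows "abelian_subvariety (torus_proj L' F' ` f ` complexify L) L' F'"
proof -
  note src = hodge_structure_weight1[OF source]
  note tgt = hodge_structure_weight1[OF target]
  define K where "K = f ` complexify L"
  define M where "M = K \<inter> L'"
  define G where "G = induced_hodge M F'"
  have K_sub: "csubspace K"
    unfolding K_def by (rule cvec_pair.linear_subspace_image[OF clinear subspace_complexify])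
  have KM: "complexify M = K"
  proof
    show "complexify M \<subseteq> K"
      unfolding complexify_def by (rule cvec.span_minimal) (auto simp: M_def K_sub)
    \<comment> \<open>The lattice \<open>M\<close> contains the image of \<open>L\<close>, which
      already spans \<open>K\<close>.\<close>
    have "f ` L \<subseteq> M"
      using lattice subset_complexify by (auto simp: M_def K_def)
    then show "K \<subseteq> complexify M"
      unfolding K_def complexify_image[OF clinear, symmetric] unfolding complexify_def
      by (rule cvec.span_mono)
  qed
  have M: "int_lattice M"
    using tgt(1) cvec.subspace_0[OF K_sub] cvec.subspace_diff[OF K_sub]
    unfolding M_def int_lattice_def by auto
  have G: "G p q = F' p q \<inter> K" for p q
    by (simp add: G_def induced_hodge_def KM)
  \<comment> \<open>The two Hodge components of \<open>y\<close> map to those of \<open>f y\<close>,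
    so \<open>K\<close> is the sum of its intersections with the two parts.\<close>
  have split: "\<exists>a\<in>G 1 0. \<exists>b\<in>G 0 1. x = a + b" if x: "x \<in> K" for x
  proof -
    obtain y where y: "y \<in> complexify L" "x = f y"
      using x by (auto simp: K_def)
    obtain a b where ab: "a \<in> F 1 0" "b \<in> F 0 1" "y = a + b"
      using src(5)[OF y(1)] by blast
    moreover have "f a \<in> K" "f b \<in> K"
      using ab src(3) unfolding K_def by blast+
    ultimately show ?thesis
      using y(2) part10 part01
      by (intro bexI[of _ "f a"] bexI[of _ "f b"]) (auto simp: G cvec_pair.linear_add[OF clinear])
  qed
  have hodge: "hodge_structure 1 M G"
  proof (rule hodge_structure_weight1I)
    show "csubspace (G p q)" for p q
      unfolding G by (rule cvec.subspace_inter[OF tgt(2) K_sub])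
    have *: "vcnj ` G p q \<subseteq> G q p" for p q
      using tgt(4)[of p q] vcnj_complexify[OF M] unfolding G KM by auto
    show "vcnj ` G p q = G q p" for p q
    proof
      show "G q p \<subseteq> vcnj ` G p q"
      proof
        fix x assume "x \<in> G q p"
        then have "vcnj x \<in> G p q"
          using *[of q p] by auto
        then show "x \<in> vcnj ` G p q"
          by (metis imageI vcnj_vcnj)
      qed
    qed (rule *)
    show "G p q = {0}" if "\<not> (0 \<le> p \<and> 0 \<le> q \<and> p + q = 1)" for p q
      using target that cvec.subspace_0[OF K_sub] unfolding G hodge_structure_def by auto
    show "G p q \<subseteq> complexify M" for p q
      by (auto simp: G KM)
  qed (use M split tgt(6) in \<open>auto simp: KM G\<close>)
  have K_tgt: "K \<subseteq> complexify L'"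
    using map_complexify K_def by simp
  have "polarizable_weight1 M G"
  proof -
    obtain E where E: "integral_form L' E"
      "\<forall>x\<in>complexify L'. \<forall>y\<in>complexify L'. E x y = - E y x"
      "\<forall>x\<in>F' 1 0. \<forall>y\<in>F' 0 1. E x (vcnj y) = 0"
      "\<forall>x\<in>F' 1 0. x \<noteq> 0 \<longrightarrow> pos_real (\<i> * E x (vcnj x))"
      using pol unfolding polarizable_weight1_def by blast
    have "integral_form M E"
      using E(1) K_tgt M_def unfolding integral_form_def cbilinear_on_def clinear_on_def KM
      by (simp add: subset_iff)
    moreover have "\<forall>x\<in>complexify M. \<forall>y\<in>complexify M. E x y = - E y x"
      using E(2) K_tgt unfolding KM by blast
    moreover have "\<forall>x\<in>G 1 0. \<forall>y\<in>G 0 1. E x (vcnj y) = 0"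
      "\<forall>x\<in>G 1 0. x \<noteq> 0 \<longrightarrow> pos_real (\<i> * E x (vcnj x))"
      using E(3,4) unfolding G by blast+
    ultimately show ?thesis
      unfolding polarizable_weight1_def by blast
  qed
  with hodge have AV: "abelian_variety M G"
    by (simp add: abelian_variety_def)
  interpret incl: hodge_morphism M G L' F' "\<lambda>x. x"
    using hodge target
    by unfold_locales (auto simp: G M_def cvec.linear_ident)
  have "inj_on (induced_torus_map L' F' (\<lambda>x. x)) (carrier (torus M G))"
  proof (rule inj_onI, unfold carrier_torus[OF hodge], clarify)
    fix x y assume xy: "x \<in> complexify M" "y \<in> complexify M"
      and "induced_torus_map L' F' (\<lambda>x. x) (torus_proj M G x) =
        induced_torus_map L' F' (\<lambda>x. x) (torus_proj M G y)"
    then have "x - y \<in> period_group L' F'"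
      by (simp add: incl.induced_torus_proj torus_proj_eq_iff[OF target])
    then obtain w l where wl: "w \<in> F' 1 0" "l \<in> L'" "x - y = w + l"
      by (auto simp: period_group_def)
    define k where "k = x - y"
    have k: "k \<in> K"
      using xy cvec.subspace_diff[OF K_sub] by (simp add: k_def KM)
    \<comment> \<open>Since \<open>l\<close> is real, \<open>w\<close> is the (1,0)-part of \<open>k - vcnj k\<close>, which lies in \<open>K\<close>.\<close>
    have "vcnj k \<in> K"
      using vcnj_complexify[OF M] k by (simp add: KM)
    then have "k - vcnj k \<in> K"
      using k cvec.subspace_diff[OF K_sub] by blast
    then obtain a b where ab: "a \<in> G 1 0" "b \<in> G 0 1" "k - vcnj k = a + b"
      using split by blast
    have "k - vcnj k = w - vcnj w"
      using wl int_lattice_subgroup(5)[OF tgt(1)] by (simp add: k_def vcnj_add)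
    then have "w - a = b + vcnj w"
      using ab(3) by (simp add: algebra_simps)
    moreover have "vcnj w \<in> F' 0 1"
      using wl(1) tgt(4)[of 1 0] by blast
    then have "w - a \<in> F' 1 0" "b + vcnj w \<in> F' 0 1"
      using ab wl cvec.subspace_diff[OF tgt(2)] cvec.subspace_add[OF tgt(2)]
      by (auto simp: G)
    ultimately have "w = a"
      using tgt(6)[of "w - a"] by simp
    then have "w \<in> G 1 0"
      using ab by simp
    \<comment> \<open>Saturation enters here: \<open>l\<close> is a difference of elements of
      \<open>K\<close> and lies in \<open>L'\<close>, hence in \<open>M\<close>.\<close>
    moreover have "l \<in> M"
    proof -
      have "l = k - w"
        using wl by (simp add: k_def)
      then show ?thesis
        using wl k \<open>w \<in> G 1 0\<close> cvec.subspace_diff[OF K_sub] by (auto simp: M_def G)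
    qed
    ultimately show "torus_proj M G x = torus_proj M G y"
      using wl(3) by (auto simp: torus_proj_eq_iff[OF hodge] period_group_def)
  qed
  moreover have "torus_proj L' F' ` f ` complexify L =
      induced_torus_map L' F' (\<lambda>x. x) ` carrier (torus M G)"
    by (simp add: incl.image_carrier KM K_def)
  ultimately show ?thesis
    unfolding abelian_subvariety_def using AV incl.abelian_variety_hom by blast
qed

end

text \<open>If \<open>w + l\<close> is real then so is \<open>w\<close>, which therefore lies in
  both Hodge parts and vanishes.\<close>

lemma real_mem_period_group:
  assumes hodge: "hodge_structure 1 L F"
    and x: "x \<in> period_group L F" and real: "vcnj x = x"
  shows "x \<in> L"
proof -
  note facts = hodge_structure_weight1[OF hodge]
  obtain w l where wl: "w \<in> F 1 0" "l \<in> L" "x = w + l"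
    using x by (auto simp: period_group_def)
  then have "vcnj w = w"
    using real int_lattice_subgroup(5)[OF facts(1) wl(2)] by (simp add: vcnj_add)
  then have "w \<in> F 0 1"
    using facts(4)[of 1 0] wl(1) by force
  then show ?thesis
    using facts(6)[OF wl(1)] wl by simp
qed

text \<open>The image is an abelian subvariety, so by simplicity it suffices to find a point with
  nonzero image; a rational multiple of \<open>u\<close> provides one.\<close>

lemma hodge_morphism_onto_simple:
  fixes f :: "'a::complex_coord_space \<Rightarrow> (complex, 'n::finite) vec"
  assumes "hodge_morphism L F vints F' f" and simple: "simple_abelian_variety vints F'"
    and u: "u \<in> L" "f u \<noteq> 0"
  shows "abelian_variety_quotient L F vints F'"
proof -
  interpret hodge_morphism L F vints F' f
    by fact
  let ?S = "torus_proj vints F' ` f ` complexify L"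
  have "abelian_subvariety ?S vints F'"
    using simple abelian_subvariety_image
    by (simp add: simple_abelian_variety_def abelian_variety_def)
  moreover have "?S \<noteq> {\<one>\<^bsub>torus vints F'\<^esub>}"
  proof
    assume triv: "?S = {\<one>\<^bsub>torus vints F'\<^esub>}"
    have int: "f u \<in> vints"
      using u lattice by auto
    obtain i where i: "f u $ i \<noteq> 0"
      using u(2) by (auto simp: vec_eq_iff)
    obtain m :: int where m: "f u $ i = of_int m"
      using int by (auto simp: vints_vec_def vints_complex_def elim: Ints_cases)
    \<comment> \<open>With this factor the \<open>i\<close>-th coordinate of
      \<open>f (r *\<^sub>C u)\<close> is 1/2. The vector is real but not integral, so it cannot be
      a period.\<close>
    define r :: complex where "r = 1 / (2 * of_int m)"
    have "r *\<^sub>C u \<in> complexify L"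
      using u subset_complexify cvec.subspace_scale[OF subspace_complexify] by blast
    then have "torus_proj vints F' (f (r *\<^sub>C u)) \<in> ?S"
      by blast
    then have "torus_proj vints F' (f (r *\<^sub>C u)) = torus_proj vints F' 0"
      unfolding triv one_torus[OF target] by simp
    then have "f (r *\<^sub>C u) \<in> period_group vints F'"
      by (simp add: torus_proj_eq_iff[OF target])
    then have "r *\<^sub>C f u \<in> period_group vints F'"
      by (simp add: cvec_pair.linear_scale[OF clinear])
    moreover have "vcnj (r *\<^sub>C f u) = r *\<^sub>C f u"
      using vcnj_vints[OF int] by (simp add: vcnj_scaleC r_def)
    ultimately have "r *\<^sub>C f u \<in> vints"
      by (rule real_mem_period_group[OF target])
    then have "r * of_int m \<in> \<int>"
      using m by (auto simp: vints_vec_def vints_complex_def scaleC_vec_def scaleC_complex_def dest: spec[of _ i])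
    moreover have "r * of_int m = 1 / 2"
      using i m by (simp add: r_def)
    ultimately show False
      using fraction_not_in_Ints[of 2 1, where ?'a = complex] by simp
  qed
  ultimately have "?S = carrier (torus vints F')"
    using simple unfolding simple_abelian_variety_def by blast
  then have "induced_torus_map vints F' f ` carrier (torus L F) = carrier (torus vints F')"
    by (simp add: image_carrier)
  with abelian_variety_hom show ?thesis
    unfolding abelian_variety_quotient_def by (intro exI conjI)
qed

section \<open>Descent of scalars\<close>

text \<open>
  A coefficient family of minimal length has no integral relation, since such a relation would
  eliminate one of the lattice vectors.
\<close>

lemma complexify_independent_coefficients:
  fixes L :: "'a::complex_coord_space set"
  assumes L: "int_lattice L" and x: "x \<in> complexify L"
  obtains I :: "'a set" and c h
  where "finite I" "h ` I \<subseteq> L" "x = (\<Sum>i\<in>I. c i *\<^sub>C h i)"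
    and "\<forall>n :: 'a \<Rightarrow> int. (\<Sum>i\<in>I. of_int (n i) * c i) = 0 \<longrightarrow> (\<forall>i\<in>I. n i = 0)"
proof -
  \<comment> \<open>Indices are kept apart from the lattice vectors \<open>h i\<close>, so that
    eliminating a term may change the vectors while the index set only shrinks.\<close>
  define rep where "rep I \<longleftrightarrow> finite I \<and> (\<exists>c h. h ` I \<subseteq> L \<and> x = (\<Sum>i\<in>I. c i *\<^sub>C h i))"
    for I :: "'a set"
  obtain T r where "finite T" "T \<subseteq> L" "x = (\<Sum>a\<in>T. r a *\<^sub>C a)"
    using x unfolding complexify_def cvec.span_explicit by blast
  then have "rep T"
    unfolding rep_def by (intro conjI exI[of _ r] exI[of _ "\<lambda>a. a"]) auto
  then obtain I where I: "rep I" and min: "\<And>J. rep J \<Longrightarrow> card I \<le> card J"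
    using ex_has_least_nat[of rep T card] by blast
  obtain c h where fin: "finite I" and h: "h ` I \<subseteq> L" and sum: "x = (\<Sum>i\<in>I. c i *\<^sub>C h i)"
    using I unfolding rep_def by blast
  have "\<forall>i\<in>I. n i = 0" if rel: "(\<Sum>i\<in>I. of_int (n i) * c i) = 0" for n :: "'a \<Rightarrow> int"
  proof (rule ccontr)
    assume "\<not> (\<forall>i\<in>I. n i = 0)"
    then obtain j where j: "j \<in> I" "n j \<noteq> 0"
      by blast
    \<comment> \<open>Solving the relation for \<open>c j\<close> would introduce the denominator
      \<open>n j\<close>. Scaling by \<open>n j\<close> keeps \<open>h' i\<close> in
      \<open>L\<close>, and the denominator moves to the coefficients
      \<open>c i / n j\<close>.\<close>
    define h' where "h' i = of_int (n j) *\<^sub>C h i - of_int (n i) *\<^sub>C h j" for i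
    have "(\<Sum>i\<in>I - {j}. c i * of_int (n i)) = - (c j * of_int (n j))"
      using rel fin j(1) by (simp add: sum.remove[of I j] mult.commute add_eq_0_iff)
    then have "(\<Sum>i\<in>I - {j}. (c i / of_int (n j)) * of_int (n i)) = - c j"
      using j(2) by (simp add: field_simps flip: sum_divide_distrib)
    moreover have "(\<Sum>i\<in>I - {j}. (c i / of_int (n j)) *\<^sub>C h' i) =
        (\<Sum>i\<in>I - {j}. c i *\<^sub>C h i) - (\<Sum>i\<in>I - {j}. (c i / of_int (n j)) * of_int (n i)) *\<^sub>C h j"
      using j(2) unfolding h'_def
      by (simp add: cvec.scale_right_diff_distrib sum_subtractf cvec.scale_sum_left)
    ultimately have "x = (\<Sum>i\<in>I - {j}. (c i / of_int (n j)) *\<^sub>C h' i)"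
      using sum fin j(1) by (simp add: sum.remove[of I j])
    moreover have "h' ` (I - {j}) \<subseteq> L"
      using h j(1) int_lattice_scale[OF L] int_lattice_subgroup(4)[OF L]
      by (simp add: h'_def image_subset_iff)
    ultimately have "rep (I - {j})"
      unfolding rep_def using fin by (intro conjI exI[of _ "\<lambda>i. c i / of_int (n j)"] exI[of _ h']) auto
    then have "card I \<le> card (I - {j})"
      by (rule min)
    then show False
      using card_Diff1_less[OF fin j(1)] by simp
  qed
  then show ?thesis
    using that[OF fin h sum] by blast
qed

text \<open>Each matrix entry of the vanishing sum is an integral relation among the
  \<open>c i\<close>. An integral linear condition on a combination thus passes to each of its
  terms.\<close>

lemma integral_matrix_independent_coefficients:
  fixes z :: "'i \<Rightarrow> complex ^ 'n ^ 'm"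
  assumes indep: "\<forall>n :: 'i \<Rightarrow> int. (\<Sum>i\<in>I. of_int (n i) * c i) = 0 \<longrightarrow> (\<forall>i\<in>I. n i = 0)"
    and z: "\<And>i. i \<in> I \<Longrightarrow> z i \<in> vints" and sum: "(\<Sum>i\<in>I. c i *\<^sub>C z i) = 0" and i: "i \<in> I"
  shows "z i = 0"
proof -
  have "z i $ p $ q = 0" for p q
  proof -
    have "\<forall>i\<in>I. \<exists>n. z i $ p $ q = of_int n"
      using z unfolding vints_vec_def vints_complex_def Ints_def by blast
    then obtain n where n: "\<And>i. i \<in> I \<Longrightarrow> z i $ p $ q = of_int (n i)"
      by metis
    have "(\<Sum>i\<in>I. of_int (n i) * c i) = (\<Sum>i\<in>I. c i *\<^sub>C z i) $ p $ q"
      using n by (simp add: sum_component scaleC_vec_def scaleC_complex_def mult.commute)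
    then show ?thesis
      using indep sum i n by simp
  qed
  then show ?thesis
    by (simp add: vec_eq_iff)
qed

section \<open>Orthogonal projection for Hermitian forms\<close>

text \<open>Gram-Schmidt, one spanning vector at a time. Anisotropy of \<open>g\<close> on
  \<open>V\<close> allows the division by \<open>g b' b'\<close> whatever the sign of the form; in
  the application the form is negative definite.\<close>

lemma orthogonal_projection_span:
  fixes g :: "'a::complex_coord_space \<Rightarrow> 'a \<Rightarrow> complex"
  assumes V: "csubspace V" and S: "finite S" "S \<subseteq> V"
    and add_left: "\<And>x y z. x \<in> V \<Longrightarrow> y \<in> V \<Longrightarrow> z \<in> V \<Longrightarrow> g (x + y) z = g x z + g y z"
    and scale_left: "\<And>c x z. x \<in> V \<Longrightarrow> z \<in> V \<Longrightarrow> g (c *\<^sub>C x) z = c * g x z"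
    and add_right: "\<And>x y z. x \<in> V \<Longrightarrow> y \<in> V \<Longrightarrow> z \<in> V \<Longrightarrow> g x (y + z) = g x y + g x z"
    and scale_right: "\<And>c x z. x \<in> V \<Longrightarrow> z \<in> V \<Longrightarrow> g x (c *\<^sub>C z) = cnj c * g x z"
    and definite: "\<And>x. x \<in> V \<Longrightarrow> g x x = 0 \<Longrightarrow> x = 0"
    and x: "x \<in> V"
  shows "\<exists>e\<in>module.span scaleC S. \<forall>u\<in>module.span scaleC S. g (x - e) u = 0"
  using S x
proof (induction S arbitrary: x rule: finite_induct)
  case empty
  have "g x 0 = 0"
    using scale_right[OF empty(2) cvec.subspace_0[OF V], of 0] by simp
  then show ?case
    by simp
next
  case (insert b S)
  have span_V: "module.span scaleC S \<subseteq> V"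
    using insert.prems V by (intro cvec.span_minimal) auto
  have b: "b \<in> V"
    using insert.prems by simp
  obtain e0 where e0: "e0 \<in> module.span scaleC S" "\<And>u. u \<in> module.span scaleC S \<Longrightarrow> g (x - e0) u = 0"
    using insert.IH[OF _ insert.prems(2)] insert.prems(1) by blast
  obtain b0 where b0: "b0 \<in> module.span scaleC S" "\<And>u. u \<in> module.span scaleC S \<Longrightarrow> g (b - b0) u = 0"
    using insert.IH[OF _ b] insert.prems(1) by blast
  show ?case
  proof (cases "b = b0")
    case True
    then show ?thesis
      using e0 b0(1) by (metis cvec.span_redundant)
  next
    case False
    \<comment> \<open>\<open>b'\<close> is the component of \<open>b\<close> orthogonal to the old
      span, and \<open>c\<close> below is the coefficient that makes the new remainder orthogonal to
      \<open>b'\<close>.\<close>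
    define b' where "b' = b - b0"
    have V_mem: "b' \<in> V" "x - e0 \<in> V"
      using b b0(1) e0(1) insert.prems(2) span_V cvec.subspace_diff[OF V] unfolding b'_def by blast+
    have "g b' b' \<noteq> 0"
      using definite[OF V_mem(1)] False by (auto simp: b'_def)
    define c where "c = g (x - e0) b' / g b' b'"
    have mono: "module.span scaleC S \<subseteq> module.span scaleC (insert b S)"
      by (intro cvec.span_mono) auto
    have "b' \<in> module.span scaleC (insert b S)"
      using b0(1) mono cvec.span_base[of b "insert b S"] cvec.span_diff unfolding b'_def by blast
    then have "e0 + c *\<^sub>C b' \<in> module.span scaleC (insert b S)"
      using e0(1) mono by (blast intro: cvec.span_add cvec.span_scale)
    moreover have "g (x - (e0 + c *\<^sub>C b')) u = 0" if u: "u \<in> module.span scaleC (insert b S)" for u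
    proof -
      obtain k where k: "u - k *\<^sub>C b \<in> module.span scaleC S"
        using cvec.span_breakdown_eq u by blast
      \<comment> \<open>Replacing \<open>b\<close> by \<open>b' + b0\<close> turns \<open>u\<close>
        into a multiple of \<open>b'\<close> plus an element \<open>w\<close> of the old
        span.\<close>
      define w where "w = u - k *\<^sub>C b + k *\<^sub>C b0"
      have w: "w \<in> module.span scaleC S"
        unfolding w_def by (intro cvec.span_add cvec.span_scale k b0(1))
      have wV: "w \<in> V"
        using w span_V by blast
      have u_eq: "u = k *\<^sub>C b' + w"
        by (simp add: w_def b'_def algebra_simps)
      have eq: "x - (e0 + c *\<^sub>C b') = (x - e0) + (- c) *\<^sub>C b'"
        by simp
      have left: "g (x - (e0 + c *\<^sub>C b')) z = g (x - e0) z - c * g b' z" if "z \<in> V" for z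
        unfolding eq using V_mem that cvec.subspace_scale[OF V]
        by (subst add_left) (auto simp: scale_left simp del: cvec.scale_minus_left)
      have mem: "x - (e0 + c *\<^sub>C b') \<in> V"
        unfolding eq using V_mem cvec.subspace_scale[OF V] cvec.subspace_add[OF V] by blast
      have "g (x - (e0 + c *\<^sub>C b')) u =
          cnj k * g (x - (e0 + c *\<^sub>C b')) b' + g (x - (e0 + c *\<^sub>C b')) w"
        unfolding u_eq
        using mem V_mem wV cvec.subspace_scale[OF V] by (simp add: add_right scale_right)
      moreover have "g (x - (e0 + c *\<^sub>C b')) w = 0"
        using left[OF wV] e0(2)[OF w] b0(2)[OF w] by (simp add: b'_def)
      moreover have "g (x - (e0 + c *\<^sub>C b')) b' = 0"
        using left[OF V_mem(1)] \<open>g b' b' \<noteq> 0\<close> by (simp add: c_def)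
      ultimately show ?thesis
        by simp
    qed
    ultimately show ?thesis
      by blast
  qed
qed

text \<open>A finite real basis exists in a Euclidean space. It also spans \<open>U\<close> over the
  complex numbers, since a complex span is a real subspace.\<close>

lemma csubspace_finitely_spanned:
  assumes "csubspace U"
  obtains S where "finite S" "module.span scaleC S = U"
proof -
  have real: "subspace W" if "csubspace W" for W :: "'a set"
    using that unfolding cvec.subspace_def real_vector.subspace_def by (metis scaleC_of_real)
  obtain S where S: "S \<subseteq> U" "independent S" "U \<subseteq> span S"
    using basis_exists[of U] by metis
  have "span S \<subseteq> module.span scaleC S"
    by (intro span_minimal real cvec.subspace_span) (auto simp: cvec.span_base)
  moreover have "module.span scaleC S \<subseteq> U"
    by (rule cvec.span_minimal[OF S(1) assms])
  ultimately show ?thesis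
    using that[of S] S finiteI_independent by blast
qed

section \<open>Matrix algebras\<close>

lemma matrix_mult_scaleC_left: "(c *\<^sub>C a) ** b = c *\<^sub>C (a ** b)"
  for a :: "complex ^ 'n ^ 'm" and b :: "complex ^ 'p ^ 'n"
  by (simp add: vec_eq_iff matrix_matrix_mult_def scaleC_vec_def scaleC_complex_def
      sum_distrib_left mult.assoc)

lemma matrix_mult_scaleC_right: "a ** (c *\<^sub>C b) = c *\<^sub>C (a ** b)"
  for a :: "complex ^ 'n ^ 'm" and b :: "complex ^ 'p ^ 'n"
  by (simp add: vec_eq_iff matrix_matrix_mult_def scaleC_vec_def scaleC_complex_def
      sum_distrib_left mult.left_commute)

lemma vcnj_matrix_mult: "vcnj (a ** b) = vcnj a ** vcnj b"
  for a :: "complex ^ 'n ^ 'm" and b :: "complex ^ 'p ^ 'n"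
  by (simp add: vec_eq_iff matrix_matrix_mult_def vcnj_vec_def vcnj_complex_def)

lemma matrix_mult_zero_left: "0 ** b = 0" for b :: "complex ^ 'p ^ 'n"
  by (simp add: vec_eq_iff matrix_matrix_mult_def)

lemma matrix_mult_zero_right: "b ** 0 = 0" for b :: "complex ^ 'p ^ 'n"
  by (simp add: vec_eq_iff matrix_matrix_mult_def)

lemma matrix_mult_add_left: "(a + b) ** c = a ** c + b ** c" for a b :: "complex ^ 'n ^ 'm"
  by (simp add: vec_eq_iff matrix_matrix_mult_def distrib_right sum.distrib)

lemma clinear_matrix_vector_mult_left: "clinear (\<lambda>a :: complex ^ 'n ^ 'm. a *v x)"
  by (rule clinearI)
    (simp_all add: vec_eq_iff matrix_vector_mult_def scaleC_vec_def scaleC_complex_def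
      sum_distrib_left mult.assoc distrib_right sum.distrib)

lemma clinear_matrix_vector_mult_right: "clinear (\<lambda>x. (a :: complex ^ 'n ^ 'm) *v x)"
  by (rule clinearI)
    (simp_all add: vec_eq_iff matrix_vector_mult_def scaleC_vec_def scaleC_complex_def
      sum_distrib_left mult.left_commute distrib_left sum.distrib)

lemma clinear_matrix_mult_right: "clinear (\<lambda>x :: complex ^ 'p ^ 'n. (a :: complex ^ 'n ^ 'm) ** x)"
  by (rule clinearI) (simp_all add: matrix_add_ldistrib matrix_mult_scaleC_right)

lemma clinear_matrix_mult_left: "clinear (\<lambda>x :: complex ^ 'n ^ 'm. x ** (a :: complex ^ 'p ^ 'n))"
  by (rule clinearI) (simp_all add: matrix_mult_add_left matrix_mult_scaleC_left)

lemmas matrix_mult_sum_left = cvec_pair.linear_sum[OF clinear_matrix_mult_left]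
lemmas matrix_mult_sum_right = cvec_pair.linear_sum[OF clinear_matrix_mult_right]

lemma mat_scaleC: "(mat k :: complex ^ 'n ^ 'n) = k *\<^sub>C mat 1"
  by (simp add: vec_eq_iff mat_def scaleC_vec_def scaleC_complex_def)

section \<open>Polarized graded algebras of weight 2\<close>

text \<open>These are conditions on \<open>H\<close> alone, without \<open>B\<close>. The assumption
  \<open>unit\<close> records that the identity of the homology of \<open>B\<close> preserves both
  Hodge parts.\<close>

locale polarized_graded_algebra =
  fixes H :: "(complex ^ 'n ^ 'n) set"
    and HH :: "int \<Rightarrow> int \<Rightarrow> (complex ^ 'n ^ 'n) set"
    and Q :: "complex ^ 'n ^ 'n \<Rightarrow> complex ^ 'n ^ 'n \<Rightarrow> complex"
    and t :: "complex ^ 'n ^ 'n \<Rightarrow> complex ^ 'n ^ 'n"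
  assumes subring: "matrix_subring H"
    and hodge: "hodge_structure 2 H HH"
    and unit: "mat 1 \<in> HH 1 1"
    and H20: "HH 2 0 \<noteq> {0}"
    and polarized: "polarization_weight2 H HH Q"
    and product: "product_bidegree_minus_one HH"
    and t_closed: "t ` H \<subseteq> H"
    and adjoint_left: "\<And>a x y. a \<in> H \<Longrightarrow> x \<in> H \<Longrightarrow> y \<in> H \<Longrightarrow> Q (a ** x) y = Q x (t a ** y)"
    and adjoint_right: "\<And>a x y. a \<in> H \<Longrightarrow> x \<in> H \<Longrightarrow> y \<in> H \<Longrightarrow> Q (x ** a) y = Q x (y ** t a)"
    and center: "{z \<in> matrix_center H. t z = z} = range (\<lambda>k :: int. mat (of_int k))"
begin

abbreviation HC :: "(complex ^ 'n ^ 'n) set"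
  where "HC \<equiv> complexify H"

lemmas HC_add = cvec.subspace_add[OF subspace_complexify[of H]]
lemmas HC_diff = cvec.subspace_diff[OF subspace_complexify[of H]]
lemmas HC_scale = cvec.subspace_scale[OF subspace_complexify[of H]]
lemmas HC_zero = cvec.subspace_0[OF subspace_complexify[of H]]

lemma int_lattice_H: "int_lattice H"
  and subspace_HH: "csubspace (HH p q)"
  and HH_subset: "HH p q \<subseteq> HC"
  and vcnj_HH_image: "vcnj ` HH p q = HH q p"
  and HH_outside: "\<not> (0 \<le> p \<and> 0 \<le> q \<and> p + q = 2) \<Longrightarrow> HH p q = {0}"
  using hodge unfolding hodge_structure_def by auto

lemma HH_HC: "x \<in> HH p q \<Longrightarrow> x \<in> HC"
  using HH_subset by blast

lemma vcnj_HH: "x \<in> HH p q \<Longrightarrow> vcnj x \<in> HH q p"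
  using vcnj_HH_image[of p q] by blast

lemma HH_decompose:
  assumes "x \<in> HC"
  obtains a b c where "a \<in> HH 2 0" "b \<in> HH 1 1" "c \<in> HH 0 2" "x = a + b + c"
proof -
  obtain c where c: "\<And>p. c p \<in> HH p (2 - p)" "x = (\<Sum>p=0..2::int. c p)"
    using hodge assms unfolding hodge_structure_def by blast
  have "{0..2::int} = {0, 1, 2}"
    by auto
  then have "x = c 2 + c 1 + c 0"
    using c(2) by (simp add: algebra_simps)
  then show ?thesis
    using that c(1)[of 0] c(1)[of 1] c(1)[of 2] by auto
qed

lemma H_mult: "a \<in> H \<Longrightarrow> b \<in> H \<Longrightarrow> a ** b \<in> H"
  using subring by (simp add: matrix_subring_def)

lemma one_H: "mat 1 \<in> H"
  using subring by (simp add: matrix_subring_def)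

lemma one_HC: "mat 1 \<in> HC"
  by (rule subset_complexify[OF one_H])

lemma HC_mult: "a \<in> HC \<Longrightarrow> b \<in> HC \<Longrightarrow> a ** b \<in> HC"
proof (induction a rule: complexify_induct)
  case (base a)
  from base(2,1) show ?case
    by (induction b rule: complexify_induct)
      (auto simp: matrix_mult_zero_right matrix_add_ldistrib matrix_mult_scaleC_right
        intro: HC_add HC_scale HC_zero H_mult subset_complexify)
qed (auto simp: matrix_mult_zero_left matrix_mult_add_left matrix_mult_scaleC_left
    intro: HC_add HC_scale HC_zero)

text \<open>Bidegree (-1,-1) makes \<open>HH 1 1\<close> the neutral part, while the products of
  equal extreme types would have type (3,-1) or (-1,3) and so vanish.\<close>

lemma HH_mult:
  shows "a \<in> HH 2 0 \<Longrightarrow> b \<in> HH 2 0 \<Longrightarrow> a ** b = 0"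
    and "a \<in> HH 2 0 \<Longrightarrow> b \<in> HH 1 1 \<Longrightarrow> a ** b \<in> HH 2 0"
    and "a \<in> HH 2 0 \<Longrightarrow> b \<in> HH 0 2 \<Longrightarrow> a ** b \<in> HH 1 1"
    and "a \<in> HH 1 1 \<Longrightarrow> b \<in> HH 2 0 \<Longrightarrow> a ** b \<in> HH 2 0"
    and "a \<in> HH 1 1 \<Longrightarrow> b \<in> HH 1 1 \<Longrightarrow> a ** b \<in> HH 1 1"
    and "a \<in> HH 1 1 \<Longrightarrow> b \<in> HH 0 2 \<Longrightarrow> a ** b \<in> HH 0 2"
    and "a \<in> HH 0 2 \<Longrightarrow> b \<in> HH 2 0 \<Longrightarrow> a ** b \<in> HH 1 1"
    and "a \<in> HH 0 2 \<Longrightarrow> b \<in> HH 1 1 \<Longrightarrow> a ** b \<in> HH 0 2"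
    and "a \<in> HH 0 2 \<Longrightarrow> b \<in> HH 0 2 \<Longrightarrow> a ** b = 0"
proof -
  have mult: "a ** b \<in> HH (p + r - 1) (q + s - 1)" if "a \<in> HH p q" "b \<in> HH r s" for a b p q r s
    using product that unfolding product_bidegree_minus_one_def by blast
  show "a \<in> HH 2 0 \<Longrightarrow> b \<in> HH 2 0 \<Longrightarrow> a ** b = 0"
    using mult[of a 2 0 b 2 0] HH_outside[of 3 "-1"] by simp
  show "a \<in> HH 0 2 \<Longrightarrow> b \<in> HH 0 2 \<Longrightarrow> a ** b = 0"
    using mult[of a 0 2 b 0 2] HH_outside[of "-1" 3] by simp
  show "a \<in> HH 2 0 \<Longrightarrow> b \<in> HH 1 1 \<Longrightarrow> a ** b \<in> HH 2 0"
    using mult[of a 2 0 b 1 1] by simp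
  show "a \<in> HH 2 0 \<Longrightarrow> b \<in> HH 0 2 \<Longrightarrow> a ** b \<in> HH 1 1"
    using mult[of a 2 0 b 0 2] by simp
  show "a \<in> HH 1 1 \<Longrightarrow> b \<in> HH 2 0 \<Longrightarrow> a ** b \<in> HH 2 0"
    using mult[of a 1 1 b 2 0] by simp
  show "a \<in> HH 1 1 \<Longrightarrow> b \<in> HH 1 1 \<Longrightarrow> a ** b \<in> HH 1 1"
    using mult[of a 1 1 b 1 1] by simp
  show "a \<in> HH 1 1 \<Longrightarrow> b \<in> HH 0 2 \<Longrightarrow> a ** b \<in> HH 0 2"
    using mult[of a 1 1 b 0 2] by simp
  show "a \<in> HH 0 2 \<Longrightarrow> b \<in> HH 2 0 \<Longrightarrow> a ** b \<in> HH 1 1"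
    using mult[of a 0 2 b 2 0] by simp
  show "a \<in> HH 0 2 \<Longrightarrow> b \<in> HH 1 1 \<Longrightarrow> a ** b \<in> HH 0 2"
    using mult[of a 0 2 b 1 1] by simp
qed

section \<open>The polarization and adjoints with respect to it\<close>

lemma Q_add_left: "x \<in> HC \<Longrightarrow> y \<in> HC \<Longrightarrow> z \<in> HC \<Longrightarrow> Q (x + y) z = Q x z + Q y z"
  and Q_scale_left: "x \<in> HC \<Longrightarrow> z \<in> HC \<Longrightarrow> Q (c *\<^sub>C x) z = c * Q x z"
  and Q_add_right: "x \<in> HC \<Longrightarrow> y \<in> HC \<Longrightarrow> z \<in> HC \<Longrightarrow> Q x (y + z) = Q x y + Q x z"
  and Q_scale_right: "x \<in> HC \<Longrightarrow> z \<in> HC \<Longrightarrow> Q x (c *\<^sub>C z) = c * Q x z"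
proof -
  have "cbilinear_on HC Q"
    using polarized by (simp add: polarization_weight2_def integral_form_def)
  then show "x \<in> HC \<Longrightarrow> y \<in> HC \<Longrightarrow> z \<in> HC \<Longrightarrow> Q (x + y) z = Q x z + Q y z"
    "x \<in> HC \<Longrightarrow> z \<in> HC \<Longrightarrow> Q (c *\<^sub>C x) z = c * Q x z"
    "x \<in> HC \<Longrightarrow> y \<in> HC \<Longrightarrow> z \<in> HC \<Longrightarrow> Q x (y + z) = Q x y + Q x z"
    "x \<in> HC \<Longrightarrow> z \<in> HC \<Longrightarrow> Q x (c *\<^sub>C z) = c * Q x z"
    by (simp_all add: cbilinear_on_def clinear_on_def)
qed

lemma Q_sym: "x \<in> HC \<Longrightarrow> y \<in> HC \<Longrightarrow> Q x y = Q y x"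
  using polarized by (simp add: polarization_weight2_def)

lemma Q_zero_left: "x \<in> HC \<Longrightarrow> Q 0 x = 0"
  using Q_scale_left[of x x 0] by simp

lemma Q_zero_right: "x \<in> HC \<Longrightarrow> Q x 0 = 0"
  using Q_scale_right[of x x 0] by simp

lemma Q_diff_right: "x \<in> HC \<Longrightarrow> y \<in> HC \<Longrightarrow> z \<in> HC \<Longrightarrow> Q x (y - z) = Q x y - Q x z"
  using Q_add_right[of x "y - z" z] HC_diff by simp

text \<open>The indices are swapped because the polarization compares \<open>x\<close> with
  \<open>vcnj y\<close>. Under \<open>Q\<close> itself \<open>HH 2 0\<close> pairs only with
  \<open>HH 0 2\<close>, and \<open>HH 1 1\<close> only with itself.\<close>

lemma Q_orthogonal:
  assumes "x \<in> HH p q" "y \<in> HH r s" "(p, q) \<noteq> (s, r)"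
  shows "Q x y = 0"
proof -
  have "Q x (vcnj (vcnj y)) = 0"
    using polarized assms(1,3) vcnj_HH[OF assms(2)] by (simp add: polarization_weight2_def)
  then show ?thesis
    by (simp add: vcnj_vcnj)
qed

lemma Q_definite:
  assumes "x \<in> HH p q" "(p, q) \<in> {(2, 0), (1, 1), (0, 2)}" "Q x (vcnj x) = 0"
  shows "x = 0"
proof (rule ccontr)
  assume "x \<noteq> 0"
  moreover have "\<forall>x\<in>HH 2 0 \<union> HH 0 2. x \<noteq> 0 \<longrightarrow> pos_real (Q x (vcnj x))"
    "\<forall>x\<in>HH 1 1. x \<noteq> 0 \<longrightarrow> pos_real (- Q x (vcnj x))"
    using polarized by (simp_all add: polarization_weight2_def)
  ultimately have "pos_real (Q x (vcnj x)) \<or> pos_real (- Q x (vcnj x))"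
    using assms(1,2) by auto
  then show False
    using assms(3) by (simp add: pos_real_def)
qed

text \<open>Pairing \<open>d\<close> with the conjugate of one of its components isolates the norm
  of that component, and \<open>Q\<close> is definite on each part.\<close>

lemma Q_nondegenerate:
  assumes d: "d \<in> HC" and zero: "\<And>x. x \<in> HC \<Longrightarrow> Q x d = 0"
  shows "d = 0"
proof -
  obtain a b c where abc: "a \<in> HH 2 0" "b \<in> HH 1 1" "c \<in> HH 0 2" "d = a + b + c"
    using HH_decompose[OF d] .
  note mem = HH_HC[OF abc(1)] HH_HC[OF abc(2)] HH_HC[OF abc(3)]
  have split: "Q a x + Q b x + Q c x = 0" if "x \<in> HC" for x
  proof -
    have "Q d x = 0"
      using zero[OF that] Q_sym[OF d that] by simp
    then show ?thesis
      using mem that by (simp add: abc(4) Q_add_left HC_add)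
  qed
  note conj = vcnj_HH[OF abc(1)] vcnj_HH[OF abc(2)] vcnj_HH[OF abc(3)]
  have "Q a (vcnj a) = 0"
    using split[of "vcnj a"] HH_HC conj Q_orthogonal[OF abc(2) conj(1)] Q_orthogonal[OF abc(3) conj(1)]
    by simp
  moreover have "Q b (vcnj b) = 0"
    using split[of "vcnj b"] HH_HC conj Q_orthogonal[OF abc(1) conj(2)] Q_orthogonal[OF abc(3) conj(2)]
    by simp
  moreover have "Q c (vcnj c) = 0"
    using split[of "vcnj c"] HH_HC conj Q_orthogonal[OF abc(1) conj(3)] Q_orthogonal[OF abc(2) conj(3)]
    by simp
  ultimately show ?thesis
    using Q_definite[OF abc(1)] Q_definite[OF abc(2)] Q_definite[OF abc(3)] abc(4) by simp
qed

text \<open>The involution \<open>t\<close> is only given on \<open>H\<close>; this relation is the graph of its complexification.\<close>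

definition adjoint :: "complex ^ 'n ^ 'n \<Rightarrow> complex ^ 'n ^ 'n \<Rightarrow> bool"
  where "adjoint a b \<longleftrightarrow> a \<in> HC \<and> b \<in> HC \<and>
    (\<forall>x\<in>HC. \<forall>y\<in>HC. Q (a ** x) y = Q x (b ** y) \<and> Q (x ** a) y = Q x (y ** b))"

lemma adjoint_base:
  assumes a: "a \<in> H"
  shows "adjoint a (t a)"
proof -
  have ta: "t a \<in> H"
    using t_closed a by auto
  note mem = subset_complexify[OF a] subset_complexify[OF ta]
  have "Q (a ** x) y = Q x (t a ** y) \<and> Q (x ** a) y = Q x (y ** t a)"
    if "x \<in> HC" "y \<in> HC" for x y
    using that
  proof (induction x rule: complexify_induct)
    case (base x)
    from base(2,1) show ?case
    proof (induction y rule: complexify_induct)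
      case (base y)
      then show ?case
        using a adjoint_left adjoint_right by blast
    qed (use mem in \<open>simp_all add: subset_complexify HC_mult Q_zero_right Q_add_right Q_scale_right
          matrix_mult_zero_left matrix_mult_zero_right matrix_mult_add_left matrix_add_ldistrib
          matrix_mult_scaleC_left matrix_mult_scaleC_right\<close>)
  qed (use mem in \<open>simp_all add: HC_mult Q_zero_left Q_add_left Q_scale_left
        matrix_mult_zero_left matrix_mult_zero_right matrix_mult_add_left matrix_add_ldistrib
        matrix_mult_scaleC_left matrix_mult_scaleC_right\<close>)
  then show ?thesis
    using mem by (simp add: adjoint_def)
qed

lemma adjoint_zero: "adjoint 0 0"
  by (simp add: adjoint_def HC_zero matrix_mult_zero_left matrix_mult_zero_right Q_zero_left Q_zero_right)

lemma adjoint_add: "adjoint a a' \<Longrightarrow> adjoint b b' \<Longrightarrow> adjoint (a + b) (a' + b')"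
  unfolding adjoint_def
  by (simp add: HC_add HC_mult Q_add_left Q_add_right matrix_mult_add_left matrix_add_ldistrib)

lemma adjoint_scale: "adjoint a a' \<Longrightarrow> adjoint (c *\<^sub>C a) (c *\<^sub>C a')"
  unfolding adjoint_def
  by (simp add: HC_scale HC_mult Q_scale_left Q_scale_right matrix_mult_scaleC_left
      matrix_mult_scaleC_right)

lemma adjoint_sum:
  "(\<And>i. i \<in> I \<Longrightarrow> adjoint (a i) (b i)) \<Longrightarrow> adjoint (\<Sum>i\<in>I. a i) (\<Sum>i\<in>I. b i)"
  by (induction I rule: infinite_finite_induct) (auto intro: adjoint_zero adjoint_add)

lemma adjoint_exists:
  assumes "a \<in> HC"
  obtains b where "adjoint a b"
proof -
  have "\<exists>b. adjoint a b"
    using assms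
    by (induction rule: complexify_induct)
      (blast intro: adjoint_zero adjoint_add adjoint_scale adjoint_base)+
  then show ?thesis
    using that by blast
qed

text \<open>The relation with \<open>y\<close> the unit determines the adjoint by
  nondegeneracy.\<close>

lemma adjoint_unique:
  assumes "adjoint a b" "adjoint a c"
  shows "b = c"
proof -
  have mem: "b \<in> HC" "c \<in> HC"
    using assms by (auto simp: adjoint_def)
  have "Q x (b - c) = 0" if x: "x \<in> HC" for x
  proof -
    have "Q x (b ** mat 1) = Q x (c ** mat 1)"
      using assms x one_HC unfolding adjoint_def by metis
    then show ?thesis
      using x mem by (simp add: Q_diff_right)
  qed
  then show ?thesis
    using Q_nondegenerate[of "b - c"] mem HC_diff by simp
qed

text \<open>This extends the assumption \<open>center\<close> from \<open>H\<close> to its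
  complexification. With coefficients independent over the integers, centrality and self-adjointness
  of \<open>f\<close> pass to each lattice vector \<open>h i\<close>, which is then an
  integer.\<close>

lemma central_self_adjoint_scalar:
  assumes f: "f \<in> HC" and central: "\<And>a. a \<in> H \<Longrightarrow> f ** a = a ** f" and adj: "adjoint f f"
  obtains k where "f = k *\<^sub>C mat 1"
proof -
  obtain I :: "(complex ^ 'n ^ 'n) set" and c h
    where I: "finite I" "h ` I \<subseteq> H" "f = (\<Sum>i\<in>I. c i *\<^sub>C h i)"
      and indep: "\<forall>n :: complex ^ 'n ^ 'n \<Rightarrow> int.
        (\<Sum>i\<in>I. of_int (n i) * c i) = 0 \<longrightarrow> (\<forall>i\<in>I. n i = 0)"
    using complexify_independent_coefficients[OF int_lattice_H f] .
  have h: "h i \<in> H" if "i \<in> I" for i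
    using I(2) that by blast
  have diff_ints: "a - b \<in> vints" if "a \<in> H" "b \<in> H" for a b
    using that int_lattice_H by (auto simp: int_lattice_def)
  have comm: "h i ** a = a ** h i" if "i \<in> I" "a \<in> H" for i a
  proof -
    have "(\<Sum>i\<in>I. c i *\<^sub>C (h i ** a - a ** h i)) = f ** a - a ** f"
      by (simp add: I(3) matrix_mult_sum_left matrix_mult_sum_right matrix_mult_scaleC_left
          matrix_mult_scaleC_right cvec.scale_right_diff_distrib sum_subtractf)
    then have "(\<Sum>i\<in>I. c i *\<^sub>C (h i ** a - a ** h i)) = 0"
      using central[OF that(2)] by simp
    moreover have "h j ** a - a ** h j \<in> vints" if "j \<in> I" for j
      using h[OF that] \<open>a \<in> H\<close> by (intro diff_ints H_mult)
    ultimately have "h i ** a - a ** h i = 0"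
      using integral_matrix_independent_coefficients[OF indep, of "\<lambda>i. h i ** a - a ** h i"] \<open>i \<in> I\<close>
      by blast
    then show ?thesis
      by simp
  qed
  have fixed: "t (h i) = h i" if "i \<in> I" for i
  proof -
    \<comment> \<open>The adjoint of \<open>f\<close> is computed termwise and compared with
      \<open>f\<close> itself by uniqueness.\<close>
    have "adjoint f (\<Sum>i\<in>I. c i *\<^sub>C t (h i))"
      unfolding I(3) using h by (intro adjoint_sum adjoint_scale adjoint_base)
    then have "(\<Sum>i\<in>I. c i *\<^sub>C t (h i)) = f"
      using adj by (rule adjoint_unique)
    then have "(\<Sum>i\<in>I. c i *\<^sub>C (t (h i) - h i)) = 0"
      by (simp add: I(3) cvec.scale_right_diff_distrib sum_subtractf)
    moreover have "t (h j) - h j \<in> vints" if "j \<in> I" for j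
      using h[OF that] t_closed by (intro diff_ints) auto
    ultimately have "t (h i) - h i = 0"
      using integral_matrix_independent_coefficients[OF indep, of "\<lambda>i. t (h i) - h i"] \<open>i \<in> I\<close>
      by blast
    then show ?thesis
      by simp
  qed
  have "\<forall>i\<in>I. \<exists>k :: int. h i = mat (of_int k)"
  proof
    fix i assume "i \<in> I"
    then have "h i \<in> {z \<in> matrix_center H. t z = z}"
      using h comm fixed by (simp add: matrix_center_def)
    then show "\<exists>k :: int. h i = mat (of_int k)"
      unfolding center by blast
  qed
  then obtain k :: "complex ^ 'n ^ 'n \<Rightarrow> int" where k: "\<And>i. i \<in> I \<Longrightarrow> h i = mat (of_int (k i))"
    by metis
  have "f = (\<Sum>i\<in>I. (c i * of_int (k i)) *\<^sub>C mat 1)"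
    unfolding I(3) by (intro sum.cong) (simp_all add: k mat_scaleC[of "of_int _"])
  then have "f = (\<Sum>i\<in>I. c i * of_int (k i)) *\<^sub>C mat 1"
    by (simp add: cvec.scale_sum_left)
  then show ?thesis
    by (rule that)
qed

text \<open>
  \<open>HH 2 0 + I11 + HH 0 2\<close> is the two-sided ideal generated by \<open>HH 2 0\<close> and \<open>HH 0 2\<close>, so an
  element of \<open>HH 1 1\<close> is orthogonal to this ideal as soon as it is orthogonal to \<open>I11\<close>.
\<close>

definition I11 :: "(complex ^ 'n ^ 'n) set"
  where "I11 = module.span scaleC
    {a ** b | a b. a \<in> HH 2 0 \<and> b \<in> HH 0 2 \<or> a \<in> HH 0 2 \<and> b \<in> HH 2 0}"

lemma subspace_I11: "csubspace I11"
  unfolding I11_def by (rule cvec.subspace_span)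

lemma I11_base:
  "a \<in> HH 2 0 \<Longrightarrow> b \<in> HH 0 2 \<Longrightarrow> a ** b \<in> I11" "a \<in> HH 0 2 \<Longrightarrow> b \<in> HH 2 0 \<Longrightarrow> a ** b \<in> I11"
  unfolding I11_def by (blast intro: cvec.span_base)+

lemma I11_induct [consumes 1, case_names zero add scale base1 base2]:
  assumes "x \<in> I11"
    and "P 0" "\<And>x y. P x \<Longrightarrow> P y \<Longrightarrow> P (x + y)" "\<And>c x. P x \<Longrightarrow> P (c *\<^sub>C x)"
    and "\<And>a b. a \<in> HH 2 0 \<Longrightarrow> b \<in> HH 0 2 \<Longrightarrow> P (a ** b)"
    and "\<And>a b. a \<in> HH 0 2 \<Longrightarrow> b \<in> HH 2 0 \<Longrightarrow> P (a ** b)"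
  shows "P x"
  using assms(1) unfolding I11_def
proof (rule cvec.span_induct)
  show "csubspace {x. P x}"
    using assms(2-4) by (auto simp: cvec.subspace_def)
qed (use assms(5,6) in blast)

lemma I11_HH: "x \<in> I11 \<Longrightarrow> x \<in> HH 1 1"
  by (induction rule: I11_induct)
    (auto intro: HH_mult cvec.subspace_0 cvec.subspace_add cvec.subspace_scale subspace_HH)

text \<open>By associativity \<open>z\<close> is absorbed into the factor next to it, whose type it
  preserves.\<close>

lemma I11_mult:
  assumes "u \<in> I11" "z \<in> HH 1 1"
  shows "u ** z \<in> I11" "z ** u \<in> I11"
proof -
  show "u ** z \<in> I11"
    using assms(1)
  proof (induction rule: I11_induct)
    case (base1 a b)
    then show ?case
      using I11_base(1)[OF base1(1) HH_mult(8)[OF base1(2) assms(2)]]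
      by (simp add: matrix_mul_assoc)
  next
    case (base2 a b)
    then show ?case
      using I11_base(2)[OF base2(1) HH_mult(2)[OF base2(2) assms(2)]]
      by (simp add: matrix_mul_assoc)
  qed (auto simp: matrix_mult_zero_left matrix_mult_add_left matrix_mult_scaleC_left
      intro: cvec.subspace_0 cvec.subspace_add cvec.subspace_scale subspace_I11)
  show "z ** u \<in> I11"
    using assms(1)
  proof (induction rule: I11_induct)
    case (base1 a b)
    then show ?case
      using I11_base(1)[OF HH_mult(4)[OF assms(2) base1(1)] base1(2)]
      by (simp add: matrix_mul_assoc)
  next
    case (base2 a b)
    then show ?case
      using I11_base(2)[OF HH_mult(6)[OF assms(2) base2(1)] base2(2)]
      by (simp add: matrix_mul_assoc)
  qed (auto simp: matrix_mult_zero_right matrix_add_ldistrib matrix_mult_scaleC_right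
      intro: cvec.subspace_0 cvec.subspace_add cvec.subspace_scale subspace_I11)
qed

lemma I11_vcnj: "u \<in> I11 \<Longrightarrow> vcnj u \<in> I11"
  by (induction rule: I11_induct)
    (auto simp: vcnj_add vcnj_scaleC vcnj_matrix_mult
      intro: cvec.subspace_0 cvec.subspace_add cvec.subspace_scale subspace_I11 I11_base vcnj_HH)

text \<open>The projection uses the Hermitian form \<open>Q x (vcnj y)\<close>, definite on
  \<open>HH 1 1\<close>. Since \<open>I11\<close> is stable under conjugation, orthogonality for it
  is orthogonality for \<open>Q\<close>.\<close>

lemma I11_orthogonal_projection:
  obtains e where "e \<in> I11" "\<forall>u\<in>I11. Q (mat 1 - e) u = 0"
proof -
  obtain S where S: "finite S" "module.span scaleC S = I11"
    using csubspace_finitely_spanned[OF subspace_I11] .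
  have "S \<subseteq> HH 1 1"
    using S(2) I11_HH cvec.span_base[of _ S] by blast
  moreover note mem = HH_HC[of _ 1 1] HH_HC[OF vcnj_HH[of _ 1 1]]
  ultimately have "\<exists>e\<in>module.span scaleC S. \<forall>u\<in>module.span scaleC S. Q (mat 1 - e) (vcnj u) = 0"
    using S(1) unit
    by (intro orthogonal_projection_span[OF subspace_HH, of S 1 1 "\<lambda>x y. Q x (vcnj y)"])
      (auto simp: vcnj_add vcnj_scaleC Q_add_left Q_add_right Q_scale_left Q_scale_right mem
        dest: Q_definite[of _ 1 1])
  then obtain e where e: "e \<in> I11" "\<And>u. u \<in> I11 \<Longrightarrow> Q (mat 1 - e) (vcnj u) = 0"
    unfolding S(2) by blast
  have "Q (mat 1 - e) u = 0" if "u \<in> I11" for u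
    using e(2)[OF I11_vcnj[OF that]] by (simp add: vcnj_vcnj)
  then show ?thesis
    using e(1) that by blast
qed

lemma one_mem_I11: "mat 1 \<in> I11"
proof -
  obtain e where e: "e \<in> I11" "\<forall>u\<in>I11. Q (mat 1 - e) u = 0"
    using I11_orthogonal_projection .
  define f where "f = mat 1 - e"
  have one: "mat 1 = e + f"
    by (simp add: f_def)
  have f: "f \<in> HH 1 1"
    unfolding f_def by (rule cvec.subspace_diff[OF subspace_HH unit I11_HH[OF e(1)]])
  note fC = HH_HC[OF f]
  have eC: "e \<in> HC"
    using e(1) I11_HH HH_HC by blast
  \<comment> \<open>\<open>HH 2 0\<close> and \<open>HH 0 2\<close> are orthogonal to
    \<open>f\<close> by type alone, \<open>I11\<close> by the choice of \<open>e\<close>.\<close>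
  have orth: "Q f u = 0" if "u \<in> HH 2 0 \<or> u \<in> I11 \<or> u \<in> HH 0 2" for u
    using that e(2) Q_orthogonal[OF f] unfolding f_def[symmetric] by fastforce
  have orth_right: "Q f (s ** x) = 0" and orth_left: "Q f (x ** s) = 0"
    if s: "s \<in> HH 2 0 \<or> s \<in> I11 \<or> s \<in> HH 0 2" and x: "x \<in> HC" for s x
  proof -
    obtain a b c where abc: "a \<in> HH 2 0" "b \<in> HH 1 1" "c \<in> HH 0 2" "x = a + b + c"
      using HH_decompose[OF x] .
    note mem = HH_HC[OF abc(1)] HH_HC[OF abc(2)] HH_HC[OF abc(3)]
    have sC: "s \<in> HC"
      using s I11_HH HH_HC by blast
    \<comment> \<open>Each of these products is zero or lies again in \<open>HH 2 0\<close>,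
      \<open>I11\<close> or \<open>HH 0 2\<close>.\<close>
    have "Q f (s ** a) = 0" "Q f (s ** b) = 0" "Q f (s ** c) = 0"
      "Q f (a ** s) = 0" "Q f (b ** s) = 0" "Q f (c ** s) = 0"
      using s abc(1-3) HH_mult I11_base I11_mult I11_HH Q_zero_right[OF fC] orth by metis+
    then show "Q f (s ** x) = 0" "Q f (x ** s) = 0"
      using mem sC fC
      by (simp_all add: abc(4) matrix_add_ldistrib matrix_mult_add_left Q_add_right HC_mult HC_add)
  qed
  have kill: "f ** s = 0" "s ** f = 0" if s: "s \<in> HH p q" and pq: "(p, q) \<in> {(2, 0), (0, 2)}" for s p q
  proof -
    have sC: "s \<in> HC"
      by (rule HH_HC[OF s])
    obtain s' where s': "adjoint s s'"
      using adjoint_exists[OF sC] .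
    then have s'C: "s' \<in> HC"
      by (simp add: adjoint_def)
    have fs: "f ** s \<in> HH p q" and sf: "s ** f \<in> HH p q"
      using HH_mult f s pq by auto
    \<comment> \<open>Moving \<open>s\<close> across the form leaves \<open>f\<close> paired with a
      multiple of \<open>vcnj (f ** s)\<close>, which is again of extreme type; so the norm of
      \<open>f ** s\<close> is zero.\<close>
    have "Q (f ** s) (vcnj (f ** s)) = Q f (vcnj (f ** s) ** s')"
      using s' fC HH_HC[OF vcnj_HH[OF fs]] unfolding adjoint_def by blast
    also have "\<dots> = 0"
      using vcnj_HH[OF fs] pq s'C by (intro orth_right) auto
    finally show "f ** s = 0"
      using Q_definite[OF fs] pq by blast
    have "Q (s ** f) (vcnj (s ** f)) = Q f (s' ** vcnj (s ** f))"
      using s' fC HH_HC[OF vcnj_HH[OF sf]] unfolding adjoint_def by blast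
    also have "\<dots> = 0"
      using vcnj_HH[OF sf] pq s'C by (intro orth_left) auto
    finally show "s ** f = 0"
      using Q_definite[OF sf] pq by blast
  qed
  have kill_I11: "f ** u = 0 \<and> u ** f = 0" if "u \<in> I11" for u
    using that
  proof (induction rule: I11_induct)
    case (base1 a b)
    then show ?case
      using kill[of a 2 0] kill[of b 0 2]
      by (simp add: matrix_mul_assoc matrix_mult_zero_left)
        (simp add: matrix_mult_zero_right flip: matrix_mul_assoc)
  next
    case (base2 a b)
    then show ?case
      using kill[of a 0 2] kill[of b 2 0]
      by (simp add: matrix_mul_assoc matrix_mult_zero_left)
        (simp add: matrix_mult_zero_right flip: matrix_mul_assoc)
  qed (simp_all add: matrix_mult_zero_left matrix_mult_zero_right matrix_mult_add_left
      matrix_add_ldistrib matrix_mult_scaleC_left matrix_mult_scaleC_right)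
  have comm11: "f ** z = z ** f" if z: "z \<in> HH 1 1" for z
  proof -
    \<comment> \<open>Inserting the unit on either side of \<open>z\<close> and dropping the terms
      in \<open>I11\<close>, which \<open>f\<close> kills, reduces both products to
      \<open>f ** z ** f\<close>.\<close>
    have "f ** z = f ** (z ** (e + f))"
      by (simp flip: one)
    also have "\<dots> = f ** (z ** f)"
      using kill_I11[OF I11_mult(2)[OF e(1) z]] by (simp add: matrix_add_ldistrib)
    also have "\<dots> = f ** z ** f"
      by (rule matrix_mul_assoc)
    also have "\<dots> = (e + f) ** z ** f"
      using kill_I11[OF I11_mult(1)[OF e(1) z]] by (simp add: matrix_mult_add_left)
    also have "\<dots> = z ** f"
      by (simp flip: one)
    finally show ?thesis .
  qed
  have comm: "f ** x = x ** f" if x: "x \<in> HC" for x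
  proof -
    obtain a b c where abc: "a \<in> HH 2 0" "b \<in> HH 1 1" "c \<in> HH 0 2" "x = a + b + c"
      using HH_decompose[OF x] .
    then show ?thesis
      using kill[of a 2 0] kill[of c 0 2] comm11[of b]
      by (simp add: matrix_add_ldistrib matrix_mult_add_left)
  qed
  \<comment> \<open>Moving \<open>x\<close> across shows \<open>f ** x\<close> orthogonal to
    \<open>e ** y\<close>. The remaining expression is symmetric in \<open>x\<close> and
    \<open>y\<close>, which makes \<open>f\<close> self-adjoint.\<close>
  have half: "Q (f ** x) y = Q (f ** x) (f ** y)" if x: "x \<in> HC" and y: "y \<in> HC" for x y
  proof -
    obtain x' where x': "adjoint x x'"
      using adjoint_exists[OF x] .
    then have x'C: "x' \<in> HC"
      by (simp add: adjoint_def)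
    have "Q (f ** x) (e ** y) = Q f (e ** y ** x')"
      using x' fC HC_mult[OF eC y] unfolding adjoint_def by blast
    also have "\<dots> = Q f (e ** (y ** x'))"
      by (simp add: matrix_mul_assoc)
    also have "\<dots> = 0"
      using e(1) HC_mult[OF y x'C] by (intro orth_right) auto
    finally have "Q (f ** x) (e ** y) = 0" .
    moreover have "y = e ** y + f ** y"
      by (simp flip: matrix_mult_add_left one)
    ultimately show ?thesis
      using Q_add_right[OF HC_mult[OF fC x] HC_mult[OF eC y] HC_mult[OF fC y]] by simp
  qed
  have "adjoint f f"
    unfolding adjoint_def
  proof (intro conjI ballI fC)
    fix x y assume xy: "x \<in> HC" "y \<in> HC"
    then show "Q (f ** x) y = Q x (f ** y)"
      using half[OF xy] half[OF xy(2,1)] Q_sym HC_mult fC by metis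
    then show "Q (x ** f) y = Q x (y ** f)"
      using comm xy by simp
  qed
  then obtain k where k: "f = k *\<^sub>C mat 1"
    using central_self_adjoint_scalar[OF fC] comm subset_complexify by blast
  \<comment> \<open>Without a nonzero element of \<open>HH 2 0\<close> the scalar \<open>k\<close>
    could be 1; here \<open>f\<close> kills \<open>s\<close>, which forces
    \<open>k = 0\<close>.\<close>
  obtain s where s: "s \<in> HH 2 0" "s \<noteq> 0"
    using H20 cvec.subspace_0[OF subspace_HH, of 2 0] by blast
  have "k *\<^sub>C s = 0"
    using kill(1)[OF s(1)] by (simp add: k matrix_mult_scaleC_left)
  then have "f = 0"
    using s(2) k by simp
  then show ?thesis
    using one e(1) by simp
qed

end

section \<open>Evaluation at an integral vector\<close>

theorem proposition3:
  fixes B :: "int \<Rightarrow> int \<Rightarrow> (complex ^ 'n) set"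
    and A :: "int \<Rightarrow> int \<Rightarrow> (complex ^ 'n ^ 'n) set"
    and H :: "(complex ^ 'n ^ 'n) set"
    and HH :: "int \<Rightarrow> int \<Rightarrow> (complex ^ 'n ^ 'n) set"
    and Q :: "complex ^ 'n ^ 'n \<Rightarrow> complex ^ 'n ^ 'n \<Rightarrow> complex"
    and t :: "complex ^ 'n ^ 'n \<Rightarrow> complex ^ 'n ^ 'n"
  assumes simple: "simple_abelian_variety vints B"
    and subring: "matrix_subring H"
    and sub_hodge: "sub_hodge_structure 2 vints (End_hodge B) H"
    and HH: "HH = induced_hodge H (End_hodge B)"
    and H20: "HH 2 0 \<noteq> {0}"
    and polarized: "polarization_weight2 H HH Q"
    and product: "product_bidegree_minus_one HH"
    and involution: "involutive_endomorphism H t"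
    and adjoint_left: "\<And>a x y. a \<in> H \<Longrightarrow> x \<in> H \<Longrightarrow> y \<in> H \<Longrightarrow> Q (a ** x) y = Q x (t a ** y)"
    and adjoint_right: "\<And>a x y. a \<in> H \<Longrightarrow> x \<in> H \<Longrightarrow> y \<in> H \<Longrightarrow> Q (x ** a) y = Q x (y ** t a)"
    and center: "{z \<in> matrix_center H. t z = z} = range (\<lambda>k :: int. mat (of_int k))"
    and A: "abelian_variety H A"
    and A_left: "left_mult_hodge_morphism H HH A"
  shows "abelian_variety_quotient H A vints B"
proof -
  have one: "mat 1 \<in> H"
    using subring by (simp add: matrix_subring_def)
  have "mat 1 \<in> HH 1 1"
    unfolding HH induced_hodge_def End_hodge_def hom_hodge_def
    using subset_complexify[OF one] by (simp add: clinear_matrix_vector_mult_right)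
  then interpret polarized_graded_algebra H HH Q t
    using assms by unfold_locales (auto simp: sub_hodge_structure_def involutive_endomorphism_def)
  have hodge_B: "hodge_structure 1 vints B"
    using simple by (simp add: simple_abelian_variety_def abelian_variety_def)
  have hodge_A: "hodge_structure 1 H A"
    using A by (simp add: abelian_variety_def)
  \<comment> \<open>Any nonzero integral vector would serve; \<open>undefined\<close> merely picks
    some coordinate axis. That \<open>v\<close> is nonzero makes the evaluation nonzero at the
    unit.\<close>
  define v :: "complex ^ 'n" where "v = axis undefined 1"
  have v: "v \<in> vints"
    by (simp add: v_def vints_vec_def vints_complex_def axis_def)
  have H_ints: "H \<subseteq> vints"
    using int_lattice_H by (simp add: int_lattice_def)
  have mult_v: "a *v v \<in> vints" if "a \<in> H" for a
    using that H_ints v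
    by (auto simp: vints_vec_def vints_complex_def matrix_vector_mult_def subset_iff
        intro!: Ints_sum Ints_mult)
  have mult_v_complex: "x *v v \<in> complexify vints" if "x \<in> HC" for x
    using that
    by (induction rule: complexify_induct)
      (auto simp: cvec_pair.linear_0[OF clinear_matrix_vector_mult_left]
        cvec_pair.linear_add[OF clinear_matrix_vector_mult_left]
        cvec_pair.linear_scale[OF clinear_matrix_vector_mult_left] subset_complexify mult_v
        intro: cvec.subspace_0 cvec.subspace_add cvec.subspace_scale subspace_complexify)
  note B10 = hodge_structure_weight1(2)[OF hodge_B, of 1 0]
  have eval10: "x *v v \<in> B 1 0" if x: "x \<in> A 1 0" for x
  proof -
    have xC: "x \<in> HC"
      using x hodge_structure_weight1(3)[OF hodge_A] by blast
    \<comment> \<open>The claim is generalized from the unit to all of \<open>I11\<close>, where it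
      can be checked on the generating products.\<close>
    have "(m ** x) *v v \<in> B 1 0" if "m \<in> I11" for m
      using that
    proof (induction rule: I11_induct)
      case (base1 a b)
      define w where "w = (b ** x) *v v"
      have "w \<in> complexify vints"
        unfolding w_def by (intro mult_v_complex HC_mult xC HH_HC[OF base1(2)])
      then obtain p q where "p \<in> B 1 0" "q \<in> B 0 1" "w = p + q"
        using hodge_structure_weight1(5)[OF hodge_B] by blast
      \<comment> \<open>The left factor has type (2,0) as an endomorphism of the homology of
        \<open>B\<close>, so it sends every vector into \<open>B 1 0\<close>.\<close>
      moreover have "(\<lambda>x. a *v x) ` B 1 0 \<subseteq> {0}" "(\<lambda>x. a *v x) ` B 0 1 \<subseteq> B 1 0"
        using base1(1) unfolding HH induced_hodge_def End_hodge_def hom_hodge_def by auto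
      ultimately have "a *v w \<in> B 1 0"
        by (simp add: matrix_vector_right_distrib image_subset_iff)
      then show ?case
        by (simp add: w_def matrix_vector_mul_assoc matrix_mul_assoc)
    next
      case (base2 a b)
      \<comment> \<open>Now the right factor has type (2,0); acting on \<open>A\<close> by left
        multiplication, it annihilates \<open>A 1 0\<close>.\<close>
      then have "(\<lambda>x. b ** x) \<in> hom_hodge H A 2 0"
        using A_left by (simp add: left_mult_hodge_morphism_def)
      then have "b ** x = 0"
        using x by (auto simp: hom_hodge_def)
      then have "a ** b ** x = 0"
        by (simp add: matrix_mult_zero_right flip: matrix_mul_assoc)
      then show ?case
        using cvec.subspace_0[OF B10] by simp
    qed (simp_all add: matrix_mult_zero_left matrix_mult_add_left matrix_mult_scaleC_left
        cvec_pair.linear_0[OF clinear_matrix_vector_mult_left]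
        cvec_pair.linear_add[OF clinear_matrix_vector_mult_left]
        cvec_pair.linear_scale[OF clinear_matrix_vector_mult_left]
        cvec.subspace_0[OF B10] cvec.subspace_add[OF B10] cvec.subspace_scale[OF B10])
    from this[OF one_mem_I11] show ?thesis
      by simp
  qed
  have "hodge_morphism H A vints B (\<lambda>x. x *v v)"
    using hodge_A hodge_B clinear_matrix_vector_mult_left mult_v eval10
    by (intro hodge_morphism.intro) auto
  then show ?thesis
    using simple one
  proof (rule hodge_morphism_onto_simple)
    show "mat 1 *v v \<noteq> 0"
      by (simp add: v_def axis_eq_0_iff)
  qed
qed

end
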